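(* Let $\mathcal M$ be an $n\times n$ binary matrix. If $n\ge 5$ and $|\operatorname{disc}(\mathcal M)|\le n-1$, then $\mathcal M$ contains a zero-sum square.
   Context: A binary matrix is a matrix with entries in $\{-1,1\}$. For a binary matrix $\mathcal M=(a_{i,j})$, its discrepancy $\operatorname{disc}(\mathcal M)$ is the sum of all its entries. A square in an $n\times n$ matrix $\mathcal M=(a_{i,j})$ is a $2\times 2$ sub-matrix of the form $\begin{pmatrix} a_{i,j} & a_{i,j+s}\\ a_{i+s,j} & a_{i+s,j+s}\end{pmatrix}$ for some positive integer $s$ (with $1\le i$, $i+s\le n$, $1\le j$, $j+s\le n$). A zero-sum square is a square whose four entries sum to $0$. *)

theory Defs
  imports "Jordan_Normal_Form.Matrix"
begin

definition binary_mat :: "int mat \<Rightarrow> bool" where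
  "binary_mat M \<longleftrightarrow> elements_mat M \<subseteq> {-1, 1}"

definition disc :: "int mat \<Rightarrow> int" where
  "disc M = (\<Sum>i<dim_row M. \<Sum>j<dim_col M. M $$ (i, j))"

text \<open>Rows and columns are indexed from 0, so the corners of a square satisfy
  \<open>i + s < dim_row M\<close> and \<open>j + s < dim_col M\<close>.\<close>

definition square_at :: "int mat \<Rightarrow> nat \<Rightarrow> nat \<Rightarrow> nat \<Rightarrow> bool" where
  "square_at M i j s \<longleftrightarrow> 0 < s \<and> i + s < dim_row M \<and> j + s < dim_col M"

definition zero_sum_square_at :: "int mat \<Rightarrow> nat \<Rightarrow> nat \<Rightarrow> nat \<Rightarrow> bool" where
  "zero_sum_square_at M i j s \<longleftrightarrow> square_at M i j s \<and>
     M $$ (i, j) + M $$ (i, j + s) + M $$ (i + s, j) + M $$ (i + s, j + s) = 0"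

definition contains_zero_sum_square :: "int mat \<Rightarrow> bool" where
  "contains_zero_sum_square M \<longleftrightarrow> (\<exists>i j s. zero_sum_square_at M i j s)"

end

theory Submission
  imports Defs
begin

text \<open>
  The theorem follows from a dichotomy (\<open>dichotomy_holds\<close>): a matrix of order \<open>n \<ge> 5\<close> without a zero-sum
  square is a staircase, that is, constant on a diagonal and on one side of it and of the opposite sign
  on the other side, or the sum of its entries exceeds \<open>n\<close> in absolute value. A staircase has sum
  \<open>n\<close> or \<open>- n\<close>, so a sum of absolute value at most \<open>n - 1\<close> is impossible in both cases.

  The dichotomy is proved by strong induction on \<open>n\<close>. Moving an \<open>m \<times> m\<close> block by one cell changes its
  sum by at most \<open>2 * m\<close>. So if every \<open>m \<times> m\<close> block has a sum larger than \<open>m\<close> in absolute value, all these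
  blocks have the same sign (\<open>same_sign\<close>). If this holds for the sizes of the four quadrants of the matrix,
  the quadrants add up to more than \<open>n\<close> (\<open>quadrant_bound\<close>). By the induction hypothesis only staircase
  blocks of about half the order can prevent this.

  Staircases, however, are rigid. A staircase block forces the neighbouring rows and columns to continue
  its pattern until the diagonal cuts off a corner of the matrix (\<open>staircase_to_corner\<close>), say with \<open>t\<close> plus
  signs on each leg of a triangle. This triangle then forces minus signs everywhere else in a square of
  side about \<open>3 * t / 2\<close> at that corner (\<open>triangle_forced\<close>, \<open>corner_region\<close>). Let \<open>p = t + 1\<close> be the largest
  side of a staircase block. If \<open>n \<ge> 2 * p + 2\<close>, the quadrants are not staircases. Otherwise the forced
  square is so large that the plus signs cannot compensate for it (\<open>corner_gap\<close>): cover the matrix by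
  the corner block, the opposite block and two blocks or rectangles beside them; the minus signs in the
  forced square exclude staircases with a plus majority from these blocks, so all of them are negative.
  Only for \<open>p = 4\<close> and \<open>n = 6, 7\<close> these blocks are too small for the induction hypothesis, and some
  more forced entries are needed instead (\<open>corner_4_in_6\<close>, \<open>corner_4_in_7\<close>).

  The induction starts with blocks of side 4, for which the dichotomy is a finite check
  (\<open>four_block\<close>), provided that they lie in a matrix of order at least 5. Orders 5, 6 and 7 need separate
  counting arguments if no block of side 4 is a staircase (\<open>no_staircase_small\<close>).
\<close>

section \<open>Signs, blocks and symmetries\<close>

text \<open>The entries are represented by their signs, \<open>True\<close> for 1. Four signs add up to zero when exactly
  two of them are \<open>True\<close>; \<open>a b\<close> and \<open>c d\<close> are the two rows of a square.\<close>

definition zero_sum :: "bool \<Rightarrow> bool \<Rightarrow> bool \<Rightarrow> bool \<Rightarrow> bool" where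
  "zero_sum a b c d \<longleftrightarrow> (a \<noteq> b \<and> c \<noteq> d) \<or> (a = b \<and> c = d \<and> a \<noteq> c)"

text \<open>Only the entries with indices below \<open>n\<close> matter, so that a block of a matrix is again such a
  function, with shifted arguments.\<close>

definition zero_sum_free :: "nat \<Rightarrow> (nat \<Rightarrow> nat \<Rightarrow> bool) \<Rightarrow> bool" where
  "zero_sum_free n P \<longleftrightarrow> (\<forall>i j s. 0 < s \<longrightarrow> i + s < n \<longrightarrow> j + s < n \<longrightarrow>
     \<not> zero_sum (P i j) (P i (j + s)) (P (i + s) j) (P (i + s) (j + s)))"

definition entry :: "bool \<Rightarrow> int" where "entry b = (if b then 1 else -1)"

text \<open>The block has its top left cell at \<open>(r, c)\<close> and \<open>a\<close> rows and \<open>b\<close> columns.\<close>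

definition block_sum :: "(nat \<Rightarrow> nat \<Rightarrow> bool) \<Rightarrow> nat \<Rightarrow> nat \<Rightarrow> nat \<Rightarrow> nat \<Rightarrow> int" where
  "block_sum P r c a b = (\<Sum>i<a. \<Sum>j<b. entry (P (r + i) (c + j)))"

definition flip :: "nat \<Rightarrow> bool \<Rightarrow> nat \<Rightarrow> nat" where
  "flip m e i = (if e then m - 1 - i else i)"

text \<open>A split matrix: one sign strictly on one side of a diagonal, the other sign on the
  diagonal and beyond. The three Booleans \<open>e\<close>, \<open>f\<close>, \<open>g\<close> range over the eight versions of this pattern
  under negation and the two reflections.\<close>

definition staircase :: "(nat \<Rightarrow> nat \<Rightarrow> bool) \<Rightarrow> nat \<Rightarrow> nat \<Rightarrow> nat \<Rightarrow> bool" where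
  "staircase P r c m \<longleftrightarrow> (\<exists>e f g. \<forall>i<m. \<forall>j<m.
     P (r + i) (c + j) = (e \<noteq> (flip m f i + flip m g j + 2 \<le> m)))"

text \<open>The normal form among the eight versions, with a plus triangle of side \<open>m - 1\<close> in the top left
  corner and block sum \<open>- m\<close>.\<close>

definition plus_corner :: "(nat \<Rightarrow> nat \<Rightarrow> bool) \<Rightarrow> nat \<Rightarrow> nat \<Rightarrow> nat \<Rightarrow> bool" where
  "plus_corner P r c m \<longleftrightarrow> (\<forall>i<m. \<forall>j<m. P (r + i) (c + j) \<longleftrightarrow> i + j + 2 \<le> m)"

text \<open>\<open>Q\<close> is \<open>P\<close> up to negation and reflections, as far as the \<open>n \<times> n\<close> matrix is concerned.\<close>

definition symm :: "nat \<Rightarrow> (nat \<Rightarrow> nat \<Rightarrow> bool) \<Rightarrow> (nat \<Rightarrow> nat \<Rightarrow> bool) \<Rightarrow> bool" where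
  "symm n P Q \<longleftrightarrow> (\<exists>e f g. \<forall>i<n. \<forall>j<n. Q i j = (e \<noteq> P (flip n f i) (flip n g j)))"

abbreviation (input) shifted :: "nat \<Rightarrow> nat \<Rightarrow> (nat \<Rightarrow> nat \<Rightarrow> bool) \<Rightarrow> nat \<Rightarrow> nat \<Rightarrow> bool" where
  "shifted r c P \<equiv> \<lambda>i j. P (r + i) (c + j)"

abbreviation (input) transposed :: "(nat \<Rightarrow> nat \<Rightarrow> bool) \<Rightarrow> nat \<Rightarrow> nat \<Rightarrow> bool" where
  "transposed P \<equiv> \<lambda>i j. P j i"

lemma zero_sum_freeD:
  assumes "zero_sum_free n P" "0 < s" "i + s < n" "j + s < n"
  shows "\<not> zero_sum (P i j) (P i (j + s)) (P (i + s) j) (P (i + s) (j + s))"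
  using assms unfolding zero_sum_free_def by blast

lemma zero_sum_transp: "zero_sum a b c d = zero_sum a c b d"
  by (cases a; cases b; cases c; cases d) (simp_all add: zero_sum_def)

lemma zero_sum_swap: "zero_sum b a d c = zero_sum a b c d" "zero_sum c d a b = zero_sum a b c d"
  "zero_sum d c b a = zero_sum a b c d"
  by (cases a; cases b; cases c; cases d; simp add: zero_sum_def)+

lemma zero_sum_not: "zero_sum (\<not> a) (\<not> b) (\<not> c) (\<not> d) = zero_sum a b c d"
  by (cases a; cases b; cases c; cases d) (simp_all add: zero_sum_def)

lemma zero_sum_free_transp: "zero_sum_free n P \<Longrightarrow> zero_sum_free n (transposed P)"
  unfolding zero_sum_free_def by (metis zero_sum_transp)

lemma zero_sum_free_shift:
  assumes "zero_sum_free n P" "r + m \<le> n" "c + m \<le> n"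
  shows "zero_sum_free m (shifted r c P)"
  unfolding zero_sum_free_def
proof (intro allI impI)
  fix i j s :: nat
  assume "0 < s" "i + s < m" "j + s < m"
  then show "\<not> zero_sum (P (r + i) (c + j)) (P (r + i) (c + (j + s))) (P (r + (i + s)) (c + j)) (P (r + (i + s)) (c + (j + s)))"
    using zero_sum_freeD[OF assms(1), of s "r + i" "c + j"] assms(2,3) by (simp add: add.assoc)
qed

lemma flip_less: "i < n \<Longrightarrow> flip n e i < n"
  by (auto simp: flip_def)

lemma flip_flip: "i < n \<Longrightarrow> flip n e (flip n e' i) = flip n (e \<noteq> e') i"
  by (auto simp: flip_def)

lemma bij_flip: "bij_betw (flip n e) {..<n} {..<n}"
  by (rule bij_betw_byWitness[where f' = "flip n e"]) (auto simp: flip_flip flip_less, auto simp: flip_def)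

lemma sum_flip:
  fixes h :: "nat \<Rightarrow> nat \<Rightarrow> int"
  shows "(\<Sum>i<n. \<Sum>j<n. h (flip n f i) (flip n g j)) = (\<Sum>i<n. \<Sum>j<n. h i j)"
  using sum.reindex_bij_betw[OF bij_flip[of n g], of "h _"]
    sum.reindex_bij_betw[OF bij_flip[of n f], of "\<lambda>i. \<Sum>j<n. h i j"] by simp

lemma flip_block:
  "r + m \<le> n \<Longrightarrow> i < m \<Longrightarrow> flip n f (r + i) = (if f then n - m - r else r) + flip m f i"
  by (auto simp: flip_def)

lemma symm_trans:
  assumes "symm n P Q" "symm n Q R"
  shows "symm n P R"
proof -
  obtain e f g where 1: "\<And>i j. i < n \<Longrightarrow> j < n \<Longrightarrow> Q i j = (e \<noteq> P (flip n f i) (flip n g j))"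
    using assms(1) unfolding symm_def by blast
  obtain e' f' g' where 2: "\<And>i j. i < n \<Longrightarrow> j < n \<Longrightarrow> R i j = (e' \<noteq> Q (flip n f' i) (flip n g' j))"
    using assms(2) unfolding symm_def by blast
  have "\<forall>i<n. \<forall>j<n. R i j = ((e \<noteq> e') \<noteq> P (flip n (f \<noteq> f') i) (flip n (g \<noteq> g') j))"
    using 1 2 by (auto simp: flip_less flip_flip)
  then show ?thesis unfolding symm_def by blast
qed

lemma entry_not: "entry (\<not> b) = - entry b" by (simp add: entry_def)

lemma entry_xor: "entry (e \<noteq> b) = (if e then - entry b else entry b)" by (cases e; cases b) (auto simp: entry_def)

lemma symm_block_sum:
  assumes "symm n P Q"
  shows "\<bar>block_sum Q 0 0 n n\<bar> = \<bar>block_sum P 0 0 n n\<bar>"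
proof -
  obtain e f g where 1: "\<And>i j. i < n \<Longrightarrow> j < n \<Longrightarrow> Q i j = (e \<noteq> P (flip n f i) (flip n g j))"
    using assms(1) unfolding symm_def by blast
  have "block_sum Q 0 0 n n = (\<Sum>i<n. \<Sum>j<n. (if e then -1 else 1) * entry (P (flip n f i) (flip n g j)))"
    unfolding block_sum_def by (intro sum.cong refl) (auto simp: 1 entry_xor entry_not)
  also have "\<dots> = (if e then -1 else 1) * (\<Sum>i<n. \<Sum>j<n. entry (P (flip n f i) (flip n g j)))"
    by (simp add: sum_distrib_left)
  also have "(\<Sum>i<n. \<Sum>j<n. entry (P (flip n f i) (flip n g j))) = (\<Sum>i<n. \<Sum>j<n. entry (P i j))"
    by (rule sum_flip[of "\<lambda>i j. entry (P i j)"])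
  finally show ?thesis unfolding block_sum_def by (simp split: if_splits)
qed

lemma zero_sum_free_symm:
  assumes "zero_sum_free n P" "symm n P Q"
  shows "zero_sum_free n Q"
  unfolding zero_sum_free_def
proof (intro allI impI)
  fix i j s :: nat
  assume s: "0 < s" "i + s < n" "j + s < n"
  obtain e f g where 1: "\<And>i j. i < n \<Longrightarrow> j < n \<Longrightarrow> Q i j = (e \<noteq> P (flip n f i) (flip n g j))"
    using assms(2) unfolding symm_def by blast
  define i' where "i' = (if f then n - 1 - (i + s) else i)"
  define j' where "j' = (if g then n - 1 - (j + s) else j)"
  have fi: "flip n f i = (if f then i' + s else i')" "flip n f (i + s) = (if f then i' else i' + s)"
    and fj: "flip n g j = (if g then j' + s else j')" "flip n g (j + s) = (if g then j' else j' + s)"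
    using s by (auto simp: flip_def i'_def j'_def)
  have lt: "i < n" "j < n" using s by auto
  note Q = 1[OF lt(1) lt(2), unfolded fi fj] 1[OF lt(1) s(3), unfolded fi fj]
    1[OF s(2) lt(2), unfolded fi fj] 1[OF s(2) s(3), unfolded fi fj]
  have "i' + s < n" "j' + s < n" using s by (auto simp: i'_def j'_def)
  from zero_sum_freeD[OF assms(1) s(1) this]
  show "\<not> zero_sum (Q i j) (Q i (j + s)) (Q (i + s) j) (Q (i + s) (j + s))"
    unfolding Q by (cases e; cases f; cases g) (simp_all add: zero_sum_not zero_sum_swap)
qed

text \<open>Reflecting the whole matrix moves an \<open>m \<times> m\<close> block and reflects it within itself.\<close>

lemma staircase_symm:
  assumes "symm n P Q" "staircase Q r c m" "r + m \<le> n" "c + m \<le> n"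
  obtains r' c' where "r' + m \<le> n" "c' + m \<le> n" "staircase P r' c' m"
proof -
  obtain e f g where 1: "\<And>i j. i < n \<Longrightarrow> j < n \<Longrightarrow> Q i j = (e \<noteq> P (flip n f i) (flip n g j))"
    using assms(1) unfolding symm_def by blast
  obtain e' f' g' where 2: "\<And>i j. i < m \<Longrightarrow> j < m \<Longrightarrow>
      Q (r + i) (c + j) = (e' \<noteq> (flip m f' i + flip m g' j + 2 \<le> m))"
    using assms(2) unfolding staircase_def by blast
  define r' where "r' = (if f then n - m - r else r)"
  define c' where "c' = (if g then n - m - c else c)"
  have "P (r' + i) (c' + j) = ((e \<noteq> e') \<noteq> (flip m (f' \<noteq> f) i + flip m (g' \<noteq> g) j + 2 \<le> m))"
    if ij: "i < m" "j < m" for i j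
  proof -
    have "flip n f (r + flip m f i) = r' + i" "flip n g (c + flip m g j) = c' + j"
      using ij assms(3,4) by (simp_all add: flip_block flip_less flip_flip r'_def c'_def) (simp_all add: flip_def)
    moreover have "r + flip m f i < n" "c + flip m g j < n"
      using ij assms(3,4) flip_less[of i m f] flip_less[of j m g] by auto
    ultimately have "Q (r + flip m f i) (c + flip m g j) = (e \<noteq> P (r' + i) (c' + j))"
      using 1 by metis
    moreover have "Q (r + flip m f i) (c + flip m g j) = (e' \<noteq> (flip m (f' \<noteq> f) i + flip m (g' \<noteq> g) j + 2 \<le> m))"
      using ij by (simp add: 2 flip_less flip_flip)
    ultimately show ?thesis by blast
  qed
  then have "staircase P r' c' m" unfolding staircase_def by blast
  moreover have "r' + m \<le> n" "c' + m \<le> n" using assms(3,4) by (auto simp: r'_def c'_def)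
  ultimately show ?thesis using that by blast
qed

lemma staircase_corner:
  assumes "staircase P r c m" "r + m \<le> n" "c + m \<le> n"
  obtains Q r' c' where "symm n P Q" "r' + m \<le> n" "c' + m \<le> n" "plus_corner Q r' c' m"
proof -
  obtain e f g where 1: "\<And>i j. i < m \<Longrightarrow> j < m \<Longrightarrow>
      P (r + i) (c + j) = (e \<noteq> (flip m f i + flip m g j + 2 \<le> m))"
    using assms(1) unfolding staircase_def by blast
  define Q where "Q = (\<lambda>i j. e \<noteq> P (flip n f i) (flip n g j))"
  define r' where "r' = (if f then n - m - r else r)"
  define c' where "c' = (if g then n - m - c else c)"
  have le: "r' + m \<le> n" "c' + m \<le> n" using assms(2,3) by (auto simp: r'_def c'_def)
  have "Q (r' + i) (c' + j) \<longleftrightarrow> i + j + 2 \<le> m" if ij: "i < m" "j < m" for i j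
  proof -
    have "flip n f (r' + i) = r + flip m f i" "flip n g (c' + j) = c + flip m g j"
      using ij assms(2,3) le by (auto simp: flip_block r'_def c'_def)
    then show ?thesis unfolding Q_def using ij by (simp add: 1 flip_less flip_flip) (auto simp: flip_def)
  qed
  then have "plus_corner Q r' c' m" unfolding plus_corner_def by blast
  moreover have "symm n P Q" unfolding symm_def Q_def by blast
  ultimately show ?thesis using that le by blast
qed

section \<open>Block sums\<close>

lemma entry_bounds: "-1 \<le> entry b" "entry b \<le> 1" by (auto simp: entry_def)

lemma block_sum_add_rows:
  "block_sum P r c (a + a') b = block_sum P r c a b + block_sum P (r + a) c a' b"
  by (induction a') (simp_all add: block_sum_def add.assoc)

lemma block_sum_transp: "block_sum (transposed P) c r b a = block_sum P r c a b"
  unfolding block_sum_def by (rule sum.swap)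

lemma block_sum_add_cols:
  "block_sum P r c a (b + b') = block_sum P r c a b + block_sum P r (c + b) a b'"
  using block_sum_add_rows[of "transposed P" c r b b' a] by (simp only: block_sum_transp[of P])

lemma block_sum_ge: "- int (a * b) \<le> block_sum P r c a b"
  and block_sum_le: "block_sum P r c a b \<le> int (a * b)"
proof -
  have "(\<Sum>i<a. \<Sum>j<b. -1) \<le> block_sum P r c a b" "block_sum P r c a b \<le> (\<Sum>i<a. \<Sum>j<b. 1)"
    unfolding block_sum_def by (intro sum_mono entry_bounds)+
  then show "- int (a * b) \<le> block_sum P r c a b" "block_sum P r c a b \<le> int (a * b)"
    by (simp_all add: sum_negf)
qed

lemma block_sum_shift: "block_sum (shifted r c P) r' c' a b = block_sum P (r + r') (c + c') a b"
  by (simp add: block_sum_def add.assoc)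

text \<open>Adding \<open>a * b\<close> to the sum counts the plus cells twice, and this count is monotone in the block.\<close>

lemma block_sum_subblock:
  assumes "r' \<le> r" "r + a \<le> r' + a'" "c' \<le> c" "c + b \<le> c' + b'"
  shows "block_sum P r c a b + int (a * b) \<le> block_sum P r' c' a' b' + int (a' * b')"
proof -
  obtain x y where x: "r = r' + x" "a' = x + a + y"
    using assms(1,2) by (metis add.assoc add_le_cancel_left le_Suc_ex)
  obtain u v where u: "c = c' + u" "b' = u + b + v"
    using assms(3,4) by (metis add.assoc add_le_cancel_left le_Suc_ex)
  have "block_sum P r' c' a' b' = block_sum P r' c' x b' + block_sum P (r' + x + a) c' y b'
     + block_sum P r c' a u + block_sum P r (c + b) a v + block_sum P r c a b"
    unfolding x u by (simp add: block_sum_add_rows block_sum_add_cols add.assoc)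
  moreover have "- int (x * b') \<le> block_sum P r' c' x b'" "- int (y * b') \<le> block_sum P (r' + x + a) c' y b'"
    "- int (a * u) \<le> block_sum P r c' a u" "- int (a * v) \<le> block_sum P r (c + b) a v"
    by (rule block_sum_ge)+
  moreover have "int (a' * b') = int (x * b') + int (y * b') + int (a * u) + int (a * v) + int (a * b)"
    unfolding x u by (simp add: algebra_simps)
  ultimately show ?thesis by linarith
qed

lemma block_sum_one_stray:
  assumes "\<And>i j. i < a \<Longrightarrow> j < b \<Longrightarrow> (i, j) \<noteq> (u, v) \<Longrightarrow> \<not> P (r + i) (c + j)"
  shows "block_sum P r c a b \<le> 2 - int (a * b)"
proof -
  have "block_sum P r c a b \<le> (\<Sum>i<a. \<Sum>j<b. (if i = u then if j = v then 2 else 0 else 0) - 1)"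
    unfolding block_sum_def using assms by (intro sum_mono) (auto simp: entry_def)
  also have "\<dots> = (\<Sum>i<a. \<Sum>j<b. if i = u then if j = v then 2 else 0 else 0) - int (a * b)"
    by (simp add: sum_subtractf)
  also have "(\<Sum>i<a. \<Sum>j<b. if i = u then if j = v then 2 else 0 else (0::int))
      = (\<Sum>i<a. if i = u then \<Sum>j<b. if j = v then 2 else 0 else 0)"
    by (intro sum.cong refl) auto
  also have "\<dots> - int (a * b) \<le> 2 - int (a * b)" by simp
  finally show ?thesis .
qed

lemma block_sum_all_minus:
  assumes "\<And>i j. i < a \<Longrightarrow> j < b \<Longrightarrow> \<not> P (r + i) (c + j)"
  shows "block_sum P r c a b = - int (a * b)"
proof -
  have "block_sum P r c a b = (\<Sum>i<a. \<Sum>j<b. -1)"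
    unfolding block_sum_def using assms by (intro sum.cong refl) (auto simp: entry_def)
  then show ?thesis by (simp add: sum_negf)
qed

lemma sum_val_less: "u \<le> m \<Longrightarrow> (\<Sum>j<m. entry (j < u)) = 2 * int u - int m"
proof (induction m)
  case (Suc m)
  then show ?case by (cases "u = Suc m") (auto simp: entry_def)
qed (simp add: entry_def)

lemma block_sum_triangle:
  assumes "t \<le> m" "\<And>i j. i < m \<Longrightarrow> j < m \<Longrightarrow> P i j \<longleftrightarrow> i + j < t"
  shows "block_sum P 0 0 m m = int t * (int t + 1) - int m * int m"
proof -
  have "(\<Sum>j<m. entry (P i j)) = 2 * int (t - i) - int m" if "i < m" for i
  proof -
    have "(\<Sum>j<m. entry (P i j)) = (\<Sum>j<m. entry (j < t - i))"
      using assms(2)[OF that] by (intro sum.cong refl) (auto simp: less_diff_conv add.commute)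
    then show ?thesis using sum_val_less[of "t - i" m] assms(1) by simp
  qed
  then have "block_sum P 0 0 m m = (\<Sum>i<m. 2 * int (t - i) - int m)"
    unfolding block_sum_def by simp
  also have "\<dots> = 2 * (\<Sum>i<m. int (t - i)) - int m * int m"
    by (simp add: sum_subtractf sum_distrib_left)
  also have "2 * (\<Sum>i<m. int (t - i)) = int t * (int t + 1)"
    using assms(1)
  proof (induction t arbitrary: m)
    case (Suc t)
    then obtain m' where m': "m = Suc m'" "t \<le> m'" by (cases m) auto
    have "(\<Sum>i<m. int (Suc t - i)) = int (Suc t) + (\<Sum>i<m'. int (t - i))"
      unfolding m' by (subst sum.lessThan_Suc_shift) simp
    with Suc.IH[OF m'(2)] show ?case by (simp add: algebra_simps)
  qed simp
  finally show ?thesis by simp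
qed

lemma staircase_sum:
  assumes "staircase P r c m" "0 < m"
  shows "\<bar>block_sum P r c m m\<bar> = int m"
proof -
  obtain e f g where 1: "\<And>i j. i < m \<Longrightarrow> j < m \<Longrightarrow>
      P (r + i) (c + j) = (e \<noteq> (flip m f i + flip m g j + 2 \<le> m))"
    using assms(1) unfolding staircase_def by blast
  have "symm m (\<lambda>i j. i + j < m - 1) (shifted r c P)"
    unfolding symm_def
  proof (intro exI allI impI)
    fix i j assume "i < m" "j < m"
    then show "P (r + i) (c + j) = (e \<noteq> (flip m f i + flip m g j < m - 1))"
      by (simp only: 1) (cases e; auto)
  qed
  then have "\<bar>block_sum P r c m m\<bar> = \<bar>block_sum (\<lambda>i j. i + j < m - 1) 0 0 m m\<bar>"
    using symm_block_sum[of m "\<lambda>i j. i + j < m - 1" "shifted r c P"] by (simp add: block_sum_shift)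
  also have "block_sum (\<lambda>i j. i + j < m - 1) 0 0 m m = - int m"
    using block_sum_triangle[of "m - 1" m] assms(2) by (simp add: of_nat_diff algebra_simps)
  finally show ?thesis by simp
qed

text \<open>A staircase of sum \<open>m\<close> has plus signs on its diagonal; this is how such staircases get excluded later.\<close>

lemma staircase_plus_cells:
  assumes "staircase P r c m" "block_sum P r c m m = int m" "0 < m"
  shows "(\<forall>i<m. \<forall>j<m. m \<le> i + j + 1 \<longrightarrow> P (r + i) (c + j)) \<or>
         (\<forall>i<m. \<forall>j<m. i + j + 1 \<le> m \<longrightarrow> P (r + i) (c + j)) \<or>
         (\<forall>i<m. \<forall>j<m. i \<le> j \<longrightarrow> P (r + i) (c + j)) \<or>
         (\<forall>i<m. \<forall>j<m. j \<le> i \<longrightarrow> P (r + i) (c + j))"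
proof -
  obtain e f g where 1: "\<And>i j. i < m \<Longrightarrow> j < m \<Longrightarrow>
      P (r + i) (c + j) = (e \<noteq> (flip m f i + flip m g j + 2 \<le> m))"
    using assms(1) unfolding staircase_def by blast
  let ?S = "block_sum (\<lambda>i j. i + j < m - 1) 0 0 m m"
  have "block_sum P r c m m = (\<Sum>i<m. \<Sum>j<m. (if e then -1 else 1) * entry (flip m f i + flip m g j < m - 1))"
    unfolding block_sum_def by (intro sum.cong refl) (auto simp: 1 entry_def)
  also have "\<dots> = (if e then -1 else 1) * (\<Sum>i<m. \<Sum>j<m. entry (flip m f i + flip m g j < m - 1))"
    by (simp add: sum_distrib_left)
  also have "(\<Sum>i<m. \<Sum>j<m. entry (flip m f i + flip m g j < m - 1)) = ?S"
    using sum_flip[of "\<lambda>i j. entry (i + j < m - 1)"] by (simp add: block_sum_def)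
  also have "?S = - int m"
    using block_sum_triangle[of "m - 1" m] assms(3) by (simp add: of_nat_diff algebra_simps)
  finally have e: e using assms(2,3) by (simp split: if_splits)
  have plus: "P (r + i) (c + j) \<longleftrightarrow> m \<le> flip m f i + flip m g j + 1" if "i < m" "j < m" for i j
    unfolding 1[OF that] using e by auto
  have cell: "P (r + i) (c + j)"
    if "i < m" "j < m" "m \<le> flip m f i + flip m g j + 1" for i j
    using plus that by blast
  have p1: "P (r + i) (c + j)" if "i < m" "j < m" "\<not> f" "\<not> g" "m \<le> i + j + 1" for i j
    by (rule cell) (use that in \<open>simp_all add: flip_def\<close>)
  have p2: "P (r + i) (c + j)" if "i < m" "j < m" "f" "g" "i + j + 1 \<le> m" for i j
    by (rule cell) (use that in \<open>simp_all add: flip_def\<close>)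
  have p3: "P (r + i) (c + j)" if "i < m" "j < m" "f" "\<not> g" "i \<le> j" for i j
    by (rule cell) (use that in \<open>simp_all add: flip_def\<close>)
  have p4: "P (r + i) (c + j)" if "i < m" "j < m" "\<not> f" "g" "j \<le> i" for i j
    by (rule cell) (use that in \<open>simp_all add: flip_def\<close>)
  consider "\<not> f" "\<not> g" | "f" "g" | "f" "\<not> g" | "\<not> f" "g" by blast
  then show ?thesis
  proof cases
    case 1
    with p1 show ?thesis by (intro disjI1) simp
  next
    case 2
    with p2 show ?thesis by simp
  next
    case 3
    with p3 show ?thesis by simp
  next
    case 4
    with p4 show ?thesis by simp
  qed
qed

text \<open>Cover the \<open>n \<times> n\<close> square by two \<open>p \<times> p\<close> squares in opposite corners and two \<open>r \<times> r\<close> squares in the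
  other corners; only the central square of side \<open>p - r\<close> is covered twice.\<close>

lemma quadrants:
  assumes "n = p + r" "r \<le> p"
  shows "block_sum P 0 0 n n = block_sum P 0 0 p p + block_sum P r r p p
     + block_sum P 0 p r r + block_sum P p 0 r r - block_sum P r r (p - r) (p - r)"
proof -
  obtain d where d: "p = r + d" using le_Suc_ex[OF assms(2)] by blast
  have "block_sum P 0 0 n n = block_sum P 0 0 p p + block_sum P 0 p r r
      + block_sum P p 0 r r + (block_sum P r p d r + block_sum P p r r d + block_sum P p p r r)"
    unfolding assms(1) d by (simp add: block_sum_add_rows block_sum_add_cols)
  moreover have se: "block_sum P r r (d + r) (d + r) = block_sum P r r d d + block_sum P r (r + d) d r
      + block_sum P (r + d) r r d + block_sum P (r + d) (r + d) r r"
    by (simp add: block_sum_add_rows block_sum_add_cols)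
  have p': "p = d + r" and pr: "p - r = d" using d by simp_all
  note se[folded d, folded p']
  ultimately show ?thesis unfolding pr by linarith
qed

section \<open>Blocks of side 4\<close>

definition rows_ok :: "nat \<Rightarrow> bool list \<Rightarrow> bool list \<Rightarrow> bool" where
  "rows_ok s u v \<longleftrightarrow>
     list_all (\<lambda>((a, b), (c, d)). \<not> zero_sum a b c d) (zip (zip u (drop s u)) (zip v (drop s v)))"

fun row_fits :: "nat \<Rightarrow> bool list list \<Rightarrow> bool list \<Rightarrow> bool" where
  "row_fits s [] v = True"
| "row_fits s (u # us) v = (if rows_ok s u v then row_fits (Suc s) us v else False)"

text \<open>All \<open>k \<times> 5\<close> matrices without a zero-sum square, as lists of rows with the last row first. This
  order makes the distance between a new row and an earlier one the position of the earlier row.\<close>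

fun strips :: "nat \<Rightarrow> bool list list list" where
  "strips 0 = [[]]"
| "strips (Suc k) = concat (map (\<lambda>us. map (\<lambda>v. v # us) (filter (row_fits 1 us) (List.n_lists 5 [True, False]))) (strips k))"

definition staircase_rows :: "bool \<Rightarrow> bool \<Rightarrow> bool \<Rightarrow> bool list list" where
  "staircase_rows e f g = map (\<lambda>i. map (\<lambda>j. e \<noteq> (flip 4 f i + flip 4 g j + 2 \<le> 4)) [0..<4]) (rev [0..<4])"

definition lopsided_or_staircase :: "bool list list \<Rightarrow> bool" where
  "lopsided_or_staircase us \<longleftrightarrow> 8 \<le> \<bar>sum_list (map (\<lambda>u. sum_list (map entry u)) us)\<bar> \<or>
     list_ex (\<lambda>e. list_ex (\<lambda>f. list_ex (\<lambda>g. us = staircase_rows e f g) [False, True]) [False, True]) [False, True]"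

text \<open>An exhaustive search over 700 matrices. There are four further \<open>4 \<times> 4\<close> matrices without a zero-sum
  square that are neither lopsided nor staircases, all of sum 0; none of them can be extended by a
  fifth column, and this is why the search runs over \<open>4 \<times> 5\<close> matrices.\<close>

lemma strips_check:
  "list_all (\<lambda>us. lopsided_or_staircase (map (take 4) us) \<and> lopsided_or_staircase (map tl us)) (strips 4)"
  by code_simp

lemma row_fitsI:
  "(\<And>i. i < length us \<Longrightarrow> rows_ok (s + i) (us ! i) v) \<Longrightarrow> row_fits s us v"
proof (induction us arbitrary: s)
  case (Cons u us)
  have "rows_ok (Suc s + i) (us ! i) v" if "i < length us" for i
    using Cons.prems[of "Suc i"] that by simp
  then have "row_fits (Suc s) us v" by (rule Cons.IH)
  then show ?case using Cons.prems[of 0] by simp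
qed simp

lemma strip_in_strips:
  assumes "\<And>i j s. 0 < s \<Longrightarrow> i + s < k \<Longrightarrow> j + s < 5 \<Longrightarrow> \<not> zero_sum (F i j) (F i (j + s)) (F (i + s) j) (F (i + s) (j + s))"
  shows "map (\<lambda>i. map (F i) [0..<5]) (rev [0..<k]) \<in> set (strips k)"
  using assms
proof (induction k)
  case (Suc k)
  let ?us = "map (\<lambda>i. map (F i) [0..<5]) (rev [0..<k])"
  let ?v = "map (F k) [0..<5]"
  have "row_fits 1 ?us ?v"
  proof (rule row_fitsI)
    fix i assume i: "i < length ?us"
    have "\<not> zero_sum (F (k - 1 - i) j) (F (k - 1 - i) (j + (1 + i))) (F k j) (F k (j + (1 + i)))"
      if "j + (1 + i) < 5" for j
      using Suc.prems[of "1 + i" "k - 1 - i" j] that i by simp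
    then have "rows_ok (1 + i) (map (F (k - 1 - i)) [0..<5]) ?v"
      unfolding rows_ok_def by (auto simp: list_all_length add.commute)
    then show "rows_ok (1 + i) (?us ! i) ?v" using i by (simp add: rev_nth)
  qed
  moreover have "?us \<in> set (strips k)" using Suc by simp
  moreover have "?v \<in> set (List.n_lists 5 [True, False])" by (auto simp: set_n_lists)
  ultimately show ?case by (auto simp del: upt_Suc simp: upt_Suc_append)
qed simp

lemma lopsided_or_staircaseD:
  assumes "lopsided_or_staircase (map (\<lambda>i. map (F i) [0..<4]) (rev [0..<4]))"
  shows "staircase F 0 0 4 \<or> 8 \<le> \<bar>block_sum F 0 0 4 4\<bar>"
proof -
  have "sum_list (map (\<lambda>u. sum_list (map entry u)) (map (\<lambda>i. map (F i) [0..<4]) (rev [0..<4]))) = block_sum F 0 0 4 4"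
    by (simp add: block_sum_def o_def rev_map[symmetric] interv_sum_list_conv_sum_set_nat atLeast0LessThan)
  moreover have "staircase F 0 0 4" if "map (\<lambda>i. map (F i) [0..<4]) (rev [0..<4]) = staircase_rows e f g" for e f g
  proof -
    have "\<forall>i\<in>{0..<4}. \<forall>j\<in>{0..<4}. F i j = (e \<noteq> (flip 4 f i + flip 4 g j + 2 \<le> 4))"
      using that unfolding staircase_rows_def map_eq_conv by simp
    then have "\<forall>i<4. \<forall>j<4. F (0 + i) (0 + j) = (e \<noteq> (flip 4 f i + flip 4 g j + 2 \<le> 4))"
      by simp
    then show ?thesis unfolding staircase_def by blast
  qed
  ultimately show ?thesis using assms unfolding lopsided_or_staircase_def by auto
qed

lemma staircase_shift: "staircase (shifted r c P) 0 0 m = staircase P r c m"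
  by (simp add: staircase_def)

text \<open>Since \<open>n \<ge> 5\<close>, the block has a neighbouring column on at least one side.\<close>

lemma four_block:
  assumes "zero_sum_free n P" "5 \<le> n" "r + 4 \<le> n" "c + 4 \<le> n"
  shows "staircase P r c 4 \<or> 8 \<le> \<bar>block_sum P r c 4 4\<bar>"
proof -
  \<comment> \<open>the leftmost of five consecutive columns that contain the block\<close>
  define c' where "c' = (if c + 5 \<le> n then c else c - 1)"
  have c': "c' + 5 \<le> n" using assms by (auto simp: c'_def)
  let ?F = "shifted r c' P"
  let ?us = "map (\<lambda>i. map (?F i) [0..<5]) (rev [0..<4])"
  have "\<not> zero_sum (?F i j) (?F i (j + s)) (?F (i + s) j) (?F (i + s) (j + s))"
    if "0 < s" "i + s < 4" "j + s < 5" for i j s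
    using zero_sum_freeD[OF assms(1) that(1), of "r + i" "c' + j"] that c' assms(3) by (simp add: add.assoc)
  then have "?us \<in> set (strips 4)" by (rule strip_in_strips)
  then have check: "lopsided_or_staircase (map (take 4) ?us)" "lopsided_or_staircase (map tl ?us)"
    using strips_check unfolding list_all_iff by blast+
  have "map (take 4) ?us = map (\<lambda>i. map (?F i) [0..<4]) (rev [0..<4])"
    by (simp add: take_map)
  moreover have "map tl ?us = map (\<lambda>i. map (shifted r (Suc c') P i) [0..<4]) (rev [0..<4])"
    by (simp add: upt_rec)
  ultimately have "staircase ?F 0 0 4 \<or> 8 \<le> \<bar>block_sum ?F 0 0 4 4\<bar>"
    and "staircase (shifted r (Suc c') P) 0 0 4 \<or> 8 \<le> \<bar>block_sum (shifted r (Suc c') P) 0 0 4 4\<bar>"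
    using check lopsided_or_staircaseD by metis+
  then have "staircase P r c' 4 \<or> 8 \<le> \<bar>block_sum P r c' 4 4\<bar>"
    and "staircase P r (Suc c') 4 \<or> 8 \<le> \<bar>block_sum P r (Suc c') 4 4\<bar>"
    unfolding staircase_shift block_sum_shift add_0_right by blast+
  moreover have "c = c' \<or> c = Suc c'" using assms by (auto simp: c'_def)
  ultimately show ?thesis by blast
qed

section \<open>Staircases grow into a corner\<close>

text \<open>This combinatorial core of the forcing arguments concerns a new line \<open>x\<close> next to a staircase block. A
  square that meets the block in two different signs forces two equal entries of \<open>x\<close>, and a square that
  meets it in two minus signs excludes two plus entries of \<open>x\<close>.\<close>

lemma line_all_minus:
  fixes x :: "nat \<Rightarrow> bool"
  assumes "3 \<le> k"
    and eq: "\<And>i s. i < s \<Longrightarrow> i + s < k \<Longrightarrow> x i = x (i + s)"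
    and ne: "\<And>i. 1 \<le> i \<Longrightarrow> i + 1 < k \<Longrightarrow> \<not> (x i \<and> x (i + 1))"
    and "i < k"
  shows "\<not> x i"
proof -
  have x0: "x i = x 0" if "i < k" for i
    using eq[of 0 i] that by (cases i) auto
  have "\<not> x 0" using x0[of 1] x0[of 2] ne[of 1] assms(1) by (auto simp: numeral_2_eq_2)
  with x0[OF assms(4)] show ?thesis by simp
qed

text \<open>The staircase with one more diagonal of plus signs than \<open>plus_corner\<close>, of sum \<open>k\<close>.\<close>

definition filled :: "(nat \<Rightarrow> nat \<Rightarrow> bool) \<Rightarrow> nat \<Rightarrow> nat \<Rightarrow> nat \<Rightarrow> bool" where
  "filled P r c k \<longleftrightarrow> (\<forall>i<k. \<forall>j<k. P (r + i) (c + j) \<longleftrightarrow> i + j < k)"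

text \<open>A square with right side in the new column and side length \<open>s\<close> has its left side in the column at
  distance \<open>s\<close>, whose entries turn from plus to minus in row \<open>s\<close>.\<close>

lemma filled_right:
  assumes "zero_sum_free n P" "filled P r c k" "3 \<le> k" "r + k \<le> n" "c + k < n" "i < k"
  shows "\<not> P (r + i) (c + k)"
proof (rule line_all_minus[OF assms(3), where x = "\<lambda>i. P (r + i) (c + k)"])
  have fil: "P (r + i) (c + j) \<longleftrightarrow> i + j < k" if "i < k" "j < k" for i j
    using assms(2) that unfolding filled_def by blast
  have sq: "\<not> zero_sum (i < s) (P (r + i) (c + k)) False (P (r + (i + s)) (c + k))"
    if "0 < s" "i + s < k" for i s
  proof -
    have "P (r + i) (c + (k - s)) \<longleftrightarrow> i < s" "\<not> P (r + (i + s)) (c + (k - s))"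
      using fil[of i "k - s"] fil[of "i + s" "k - s"] that by auto
    moreover have "\<not> zero_sum (P (r + i) (c + (k - s))) (P (r + i) (c + (k - s) + s))
        (P (r + i + s) (c + (k - s))) (P (r + i + s) (c + (k - s) + s))"
      using that assms(4,5) by (intro zero_sum_freeD[OF assms(1)]) auto
    moreover have "c + (k - s) + s = c + k" "r + i + s = r + (i + s)" using that by auto
    ultimately show ?thesis by simp
  qed
  show "P (r + i) (c + k) = P (r + (i + s)) (c + k)" if "i < s" "i + s < k" for i s
    using sq[of s i] that by (auto simp: zero_sum_def)
  show "\<not> (P (r + i) (c + k) \<and> P (r + (i + 1)) (c + k))" if "1 \<le> i" "i + 1 < k" for i
    using sq[of 1 i] that by (auto simp: zero_sum_def)
qed (rule assms(6))

text \<open>Rotating by a half turn and negating turns a \<open>plus_corner\<close> block into a \<open>filled\<close> one and the column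
  on its left into the column on the right. Hence the same argument applies, with rows in reverse
  order and signs exchanged.\<close>

lemma corner_left:
  assumes "zero_sum_free n P" "plus_corner P r c k" "3 \<le> k" "r + k \<le> n" "c + k \<le> n" "0 < c" "i < k"
  shows "P (r + i) (c - 1)"
proof -
  have cor: "P (r + i) (c + j) \<longleftrightarrow> i + j + 2 \<le> k" if "i < k" "j < k" for i j
    using assms(2) that unfolding plus_corner_def by blast
  have "\<not> \<not> P (r + (k - 1 - (k - 1 - i))) (c - 1)"
  proof (rule line_all_minus[OF assms(3), where x = "\<lambda>i. \<not> P (r + (k - 1 - i)) (c - 1)"])
    have sq: "\<not> zero_sum (P (r + (k - 1 - (i + s))) (c - 1)) True (P (r + (k - 1 - i)) (c - 1)) (s \<le> i)"
      if "0 < s" "i + s < k" for i s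
    proof -
      have "P (r + (k - 1 - (i + s))) (c + (s - 1))" "P (r + (k - 1 - i)) (c + (s - 1)) \<longleftrightarrow> s \<le> i"
        using cor[of "k - 1 - (i + s)" "s - 1"] cor[of "k - 1 - i" "s - 1"] that by auto
      moreover have "\<not> zero_sum (P (r + (k - 1 - (i + s))) (c - 1)) (P (r + (k - 1 - (i + s))) (c - 1 + s))
          (P (r + (k - 1 - (i + s)) + s) (c - 1)) (P (r + (k - 1 - (i + s)) + s) (c - 1 + s))"
        using that assms(4,5) by (intro zero_sum_freeD[OF assms(1)]) auto
      moreover have "c - 1 + s = c + (s - 1)" "r + (k - 1 - (i + s)) + s = r + (k - 1 - i)"
        using that assms(6) by auto
      ultimately show ?thesis by (simp only: simp_thms)
    qed
    show "(\<not> P (r + (k - 1 - i)) (c - 1)) = (\<not> P (r + (k - 1 - (i + s))) (c - 1))"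
      if "i < s" "i + s < k" for i s
      using sq[of s i] that by (auto simp: zero_sum_def)
    show "\<not> (\<not> P (r + (k - 1 - i)) (c - 1) \<and> \<not> P (r + (k - 1 - (i + 1))) (c - 1))"
      if "1 \<le> i" "i + 1 < k" for i
      using sq[of 1 i] that by (auto simp: zero_sum_def)
  qed (use assms(7) in auto)
  then show ?thesis using assms(7) by simp
qed

lemma plus_corner_transp: "plus_corner (transposed P) c r k = plus_corner P r c k"
  unfolding plus_corner_def by (metis add.commute)

lemma filled_transp: "filled (transposed P) c r k = filled P r c k"
  unfolding filled_def by (metis add.commute)

text \<open>The new cell on the diagonal is opposite to the plus cell \<open>(r, c)\<close> in a square whose two other corners
  are minus.\<close>

lemma filled_grow:
  assumes "zero_sum_free n P" "filled P r c k" "3 \<le> k" "r + k < n" "c + k < n"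
  shows "plus_corner P r c (k + 1)"
proof -
  have fil: "P (r + i) (c + j) \<longleftrightarrow> i + j < k" if "i < k" "j < k" for i j
    using assms(2) that unfolding filled_def by blast
  have right: "\<not> P (r + i) (c + k)" if "i < k" for i
    using filled_right[OF assms(1-3)] assms(4,5) that by simp
  have down: "\<not> P (r + k) (c + j)" if "j < k" for j
    using filled_right[OF zero_sum_free_transp[OF assms(1)], of c r k j] assms that by (simp add: filled_transp[of P])
  have "\<not> zero_sum (P r c) (P r (c + k)) (P (r + k) c) (P (r + k) (c + k))"
    using assms(3-5) by (intro zero_sum_freeD[OF assms(1)]) auto
  then have "\<not> P (r + k) (c + k)"
    using right[of 0] down[of 0] fil[of 0 0] assms(3) by (auto simp: zero_sum_def)
  then show ?thesis
    unfolding plus_corner_def using right down fil by (auto simp: less_Suc_eq)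
qed

text \<open>The new row on top is all plus; together with the upper \<open>k - 1\<close> rows of the block it forms a
  \<open>filled\<close> block, which then determines the column on the right.\<close>

lemma corner_up:
  assumes "zero_sum_free n P" "plus_corner P r c k" "3 \<le> k" "0 < r" "r + k \<le> n" "c + k < n"
  shows "plus_corner P (r - 1) c (k + 1)"
proof (rule filled_grow[OF assms(1) _ assms(3)])
  have up: "P (r - 1) (c + j)" if "j < k" for j
    using corner_left[OF zero_sum_free_transp[OF assms(1)], of c r k j] assms that by (simp add: plus_corner_transp[of P])
  have cor: "P (r + i) (c + j) \<longleftrightarrow> i + j + 2 \<le> k" if "i < k" "j < k" for i j
    using assms(2) that unfolding plus_corner_def by blast
  show "filled P (r - 1) c k"
    unfolding filled_def
  proof (intro allI impI)
    fix i j assume "i < k" "j < k"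
    then show "P (r - 1 + i) (c + j) \<longleftrightarrow> i + j < k"
      using up[of j] cor[of "i - 1" j] assms(4) by (cases i) auto
  qed
qed (use assms(4-6) in auto)

text \<open>The bound \<open>r + c + k \<le> n\<close> says that the diagonal of the staircase meets the top and the left side of
  the matrix, so there is always room for the larger block.\<close>

lemma corner_grow:
  assumes "zero_sum_free n P" "plus_corner P r c k" "3 \<le> k" "r + c + k \<le> n"
  shows "plus_corner P 0 0 (r + c + k)"
  using assms
proof (induction "r + c" arbitrary: r c k)
  case (Suc m)
  consider "0 < r" | "r = 0" "0 < c" using Suc.hyps(2) by auto
  then show ?case
  proof cases
    case 1
    have "plus_corner P (r - 1) c (k + 1)" using Suc.prems 1 by (intro corner_up) auto
    then have "plus_corner P 0 0 (r - 1 + c + (k + 1))" using Suc.prems Suc.hyps(2) 1 by (intro Suc.hyps(1)) auto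
    moreover have "r - 1 + c + (k + 1) = r + c + k" using 1 by simp
    ultimately show ?thesis by simp
  next
    case 2
    have "plus_corner (transposed P) (c - 1) r (k + 1)"
      using corner_up[OF zero_sum_free_transp[OF Suc.prems(1)], of c r k] Suc.prems 2
      by (simp add: plus_corner_transp[of P])
    then have "plus_corner P r (c - 1) (k + 1)" by (simp add: plus_corner_transp[of P])
    then have "plus_corner P 0 0 (r + (c - 1) + (k + 1))" using Suc.prems Suc.hyps(2) 2 by (intro Suc.hyps(1)) auto
    moreover have "r + (c - 1) + (k + 1) = r + c + k" using 2 by simp
    ultimately show ?thesis by simp
  qed
qed simp

text \<open>If the diagonal of the staircase, once in normal form, runs below the main antidiagonal of the
  matrix, a half turn with negation moves it above, at the price of exchanging the two forms
  \<open>plus_corner\<close> and \<open>filled\<close>.\<close>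

lemma staircase_to_corner:
  assumes "zero_sum_free n P" "staircase P r c m" "3 \<le> m" "r + m \<le> n" "c + m \<le> n"
  obtains Q p where "symm n P Q" "m \<le> p" "p \<le> n" "plus_corner Q 0 0 p"
proof -
  obtain Q r c where Q: "symm n P Q" "r + m \<le> n" "c + m \<le> n" "plus_corner Q r c m"
    using staircase_corner[OF assms(2,4,5)] .
  have sfQ: "zero_sum_free n Q" by (rule zero_sum_free_symm[OF assms(1) Q(1)])
  show ?thesis
  proof (cases "r + c + m \<le> n")
    case True
    from corner_grow[OF sfQ Q(4) assms(3) this] show ?thesis by (intro that[OF Q(1)]) (use True in auto)
  next
    case False
    \<comment> \<open>a half turn combined with negation\<close>
    define R where "R = (\<lambda>i j. \<not> Q (flip n True i) (flip n True j))"
    have "\<forall>i<n. \<forall>j<n. R i j = (True \<noteq> Q (flip n True i) (flip n True j))" by (simp add: R_def)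
    then have QR: "symm n Q R" unfolding symm_def by blast
    define r' where "r' = n - m - r"
    define c' where "c' = n - m - c"
    have "R (r' + i) (c' + j) \<longleftrightarrow> i + j < m" if "i < m" "j < m" for i j
    proof -
      have "flip n True (r' + i) = r + (m - 1 - i)" "flip n True (c' + j) = c + (m - 1 - j)"
        using that Q(2,3) by (auto simp: flip_def r'_def c'_def)
      moreover have "Q (r + (m - 1 - i)) (c + (m - 1 - j)) \<longleftrightarrow> (m - 1 - i) + (m - 1 - j) + 2 \<le> m"
        using that by (intro Q(4)[unfolded plus_corner_def, rule_format]) auto
      ultimately show ?thesis using that unfolding R_def by auto
    qed
    then have "filled R r' c' m" unfolding filled_def by blast
    moreover have "r' + m < n" "c' + m < n" using False Q(2,3) by (auto simp: r'_def c'_def)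
    moreover have sfR: "zero_sum_free n R" by (rule zero_sum_free_symm[OF sfQ QR])
    ultimately have "plus_corner R r' c' (m + 1)" using filled_grow assms(3) by blast
    moreover have "r' + c' + (m + 1) \<le> n" using False Q(2,3) by (auto simp: r'_def c'_def)
    ultimately have "plus_corner R 0 0 (r' + c' + (m + 1))" using corner_grow[OF sfR, of r' c' "m + 1"] assms(3) by simp
    then show ?thesis
      using \<open>r' + c' + (m + 1) \<le> n\<close> by (intro that[OF symm_trans[OF Q(1) QR], of "r' + c' + (m + 1)"]) auto
  qed
qed

definition triangle :: "(nat \<Rightarrow> nat \<Rightarrow> bool) \<Rightarrow> nat \<Rightarrow> nat \<Rightarrow> bool" where
  "triangle P t m \<longleftrightarrow> (\<forall>i<m. \<forall>j<m. P i j \<longleftrightarrow> i + j < t)"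

lemma triangle_transp: "triangle (transposed P) t m = triangle P t m"
  unfolding triangle_def by (metis add.commute)

text \<open>Let \<open>g = c + 1 - t\<close>. A square with right side in column \<open>c\<close>, starting in row \<open>i\<close>, meets the plus
  triangle with exactly one corner if its side is at least \<open>i + g\<close>; then its two entries in column \<open>c\<close>
  agree. So the entry in row 0 agrees with all entries from row \<open>g\<close> on, two of which are adjacent and
  cannot both be plus. A row \<open>i\<close> strictly between 0 and \<open>g\<close> is tied to row \<open>2 * i + g\<close>, which is less than
  \<open>c\<close> only if \<open>i < t div 2\<close>.\<close>

lemma triangle_next_column:
  assumes "zero_sum_free n P" "triangle P t c" "3 \<le> t" "t < c" "c < n"
    and "i < c" "c + 1 - t \<le> i \<or> i < t div 2"
  shows "\<not> P i c"
proof -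
  define g where "g = c + 1 - t"
  have g: "2 \<le> g" "g + t = c + 1" using assms(4) by (auto simp: g_def)
  have tri: "P i j \<longleftrightarrow> i + j < t" if "i < c" "j < c" for i j
    using assms(2) that unfolding triangle_def by blast
  have sq: "\<not> zero_sum (i + g \<le> s) (P i c) False (P (i + s) c)" if "0 < s" "i + s < c" for i s
  proof -
    have "P i (c - s) \<longleftrightarrow> i + g \<le> s" "\<not> P (i + s) (c - s)"
      using that g by (auto simp: tri)
    moreover have "\<not> zero_sum (P i (c - s)) (P i (c - s + s)) (P (i + s) (c - s)) (P (i + s) (c - s + s))"
      using that assms(5) by (intro zero_sum_freeD[OF assms(1)]) auto
    ultimately show ?thesis using that by simp
  qed
  have eq: "P i c = P (i + s) c" if "i + g \<le> s" "i + s < c" for i s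
    using sq[of s i] that g by (auto simp: zero_sum_def)
  have "\<not> (P g c \<and> P (g + 1) c)" using sq[of 1 g] g assms(3) by (auto simp: zero_sum_def)
  moreover have "P 0 c = P g c" "P 0 c = P (g + 1) c" using eq[of 0 g] eq[of 0 "g + 1"] g assms(3) by auto
  ultimately have 0: "\<not> P 0 c" by blast
  have low: "\<not> P i c" if "g \<le> i" "i < c" for i using eq[of 0 i] 0 that by simp
  show ?thesis
  proof (cases "g \<le> i")
    case False
    then have i: "i < t div 2" using assms(7) by (simp add: g_def)
    then have "P i c = P (i + (i + g)) c" using g by (intro eq) auto
    moreover have "\<not> P (i + (i + g)) c" using i g by (intro low) auto
    ultimately show ?thesis by simp
  qed (use low assms(6) in blast)
qed

lemma triangle_next_corner:
  assumes "zero_sum_free n P" "triangle P t c" "3 \<le> t" "t < c" "c < n"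
  shows "\<not> P c c"
proof -
  have "\<not> P 0 c" using assms by (intro triangle_next_column[OF assms(1,2)]) auto
  moreover have "\<not> P c 0"
    using triangle_next_column[OF zero_sum_free_transp[OF assms(1)], of t c 0] assms by (simp add: triangle_transp[of P])
  moreover have "P 0 0" using assms unfolding triangle_def by simp
  moreover have "\<not> zero_sum (P 0 0) (P 0 (0 + c)) (P (0 + c) 0) (P (0 + c) (0 + c))"
    using assms by (intro zero_sum_freeD[OF assms(1)]) auto
  ultimately show ?thesis by (auto simp: zero_sum_def)
qed

text \<open>Up to side \<open>t + t div 2\<close> the two ranges of rows in the previous lemma cover the whole column.\<close>

lemma triangle_forced:
  assumes "zero_sum_free n P" "plus_corner P 0 0 (t + 1)" "3 \<le> t" "t < m" "m \<le> n" "m \<le> t + t div 2"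
  shows "triangle P t m"
  using assms(4-6)
proof (induction m)
  case (Suc m)
  show ?case
  proof (cases "m = t")
    case True
    then show ?thesis using assms(2) unfolding triangle_def plus_corner_def by auto
  next
    case False
    then have tri: "triangle P t m" and m: "t < m" "m < n" using Suc by auto
    have split: "m + 1 - t \<le> i \<or> i < t div 2" for i
      using Suc.prems(3) by linarith
    have col: "\<not> P i m" if "i < m" for i
      by (rule triangle_next_column[OF assms(1) tri assms(3) m that split])
    have row: "\<not> P m i" if "i < m" for i
      using triangle_next_column[OF zero_sum_free_transp[OF assms(1)], of t m i] tri assms(3) m that split[of i]
      by (simp add: triangle_transp[of P])
    have "\<not> P m m" by (rule triangle_next_corner[OF assms(1) tri assms(3) m])
    with col row tri m show ?thesis unfolding triangle_def by (auto simp: less_Suc_eq)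
  qed
qed simp

section \<open>Matrices without staircases\<close>

lemma block_sum_not: "block_sum (\<lambda>i j. \<not> P i j) r c a b = - block_sum P r c a b"
  by (simp add: block_sum_def entry_not sum_negf)

lemma block_sum_subblock_le:
  assumes "r' \<le> r" "r + a \<le> r' + a'" "c' \<le> c" "c + b \<le> c' + b'"
  shows "block_sum P r' c' a' b' - int (a' * b') \<le> block_sum P r c a b - int (a * b)"
  using block_sum_subblock[OF assms, of "\<lambda>i j. \<not> P i j"] by (simp add: block_sum_not)

lemma block_sum_slide: "block_sum P r (c + 1) m m \<le> block_sum P r c m m + 2 * int m"
proof -
  have "block_sum P r (c + 1) m m + int (m * m) \<le> block_sum P r c m (m + 1) + int (m * (m + 1))"
    by (rule block_sum_subblock) auto
  moreover have "block_sum P r c m (m + 1) - int (m * (m + 1)) \<le> block_sum P r c m m - int (m * m)"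
    by (rule block_sum_subblock_le) auto
  ultimately show ?thesis by (simp add: algebra_simps)
qed

text \<open>Moving a block by one cell changes its sum by at most \<open>2 * m\<close>, so the sum cannot jump from below
  \<open>- m\<close> to above \<open>m\<close>.\<close>

lemma same_sign:
  assumes big: "\<And>r c. r + m \<le> n \<Longrightarrow> c + m \<le> n \<Longrightarrow> int m < \<bar>block_sum P r c m m\<bar>"
    and neg: "block_sum P 0 0 m m < 0"
    and fits: "r + m \<le> n" "c + m \<le> n"
  shows "block_sum P r c m m < - int m"
proof -
  have top: "block_sum P 0 c m m < - int m" if "c + m \<le> n" for c
    using that
  proof (induction c)
    case 0
    then show ?case using big[of 0 0] neg by simp
  next
    case (Suc c)
    then show ?case using big[of 0 "Suc c"] block_sum_slide[of P 0 c m] by simp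
  qed
  show ?thesis using fits(1)
  proof (induction r)
    case 0
    then show ?case using top[OF fits(2)] by simp
  next
    case (Suc r)
    have "block_sum P (r + 1) c m m \<le> block_sum P r c m m + 2 * int m"
      using block_sum_slide[of "transposed P" c r m] by (simp only: block_sum_transp[of P])
    with Suc big[of "Suc r" c] fits(2) show ?case by simp
  qed
qed

text \<open>Passing from a block of side \<open>m + 1\<close> to a block of side \<open>m\<close> inside it changes the sum by at most
  \<open>2 * m + 1\<close>, which from \<open>- (m + 1)\<close> leads to at most \<open>m\<close>. So excluding the value \<open>m\<close> keeps the sums
  negative all the way down.\<close>

lemma nested_blocks:
  assumes "r \<le> p" "block_sum P (a p) (b p) p p \<le> - int p"
    and "\<And>m. r \<le> m \<Longrightarrow> m < p \<Longrightarrow> a (Suc m) \<le> a m \<and> a m \<le> Suc (a (Suc m)) \<and> b (Suc m) \<le> b m \<and> b m \<le> Suc (b (Suc m))"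
    and "\<And>m. r \<le> m \<Longrightarrow> m < p \<Longrightarrow>
      int m \<le> \<bar>block_sum P (a m) (b m) m m\<bar> \<and> block_sum P (a m) (b m) m m \<noteq> int m"
  shows "block_sum P (a r) (b r) r r \<le> - int r"
  using assms(1)
proof (induction rule: inc_induct)
  case (step m)
  have "block_sum P (a m) (b m) m m + int (m * m)
      \<le> block_sum P (a (Suc m)) (b (Suc m)) (Suc m) (Suc m) + int (Suc m * Suc m)"
    using assms(3)[OF step.hyps] by (intro block_sum_subblock) auto
  then have "block_sum P (a m) (b m) m m \<le> int m" using step.IH by (simp add: algebra_simps)
  with assms(4)[OF step.hyps] show ?case by linarith
qed (rule assms(2))

lemma block_sum_min_cells:
  assumes "block_sum P r c a b \<le> - int (a * b)" "i < a" "j < b"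
  shows "\<not> P (r + i) (c + j)"
proof
  assume "P (r + i) (c + j)"
  then have "block_sum P (r + i) (c + j) 1 1 = 1" by (simp add: block_sum_def entry_def)
  with block_sum_subblock[of r "r + i" 1 a c "c + j" 1 b P] assms show False by simp
qed

text \<open>All blocks of side \<open>p\<close> are negative, hence so are the blocks of side \<open>k\<close> inside them, and four
  negative quadrants add up to more than \<open>n\<close> in absolute value.\<close>

lemma quadrant_bound_neg:
  assumes "n = p + k" "k \<le> p" "p \<le> k + 1"
    and kb: "\<And>r c. r + k \<le> n \<Longrightarrow> c + k \<le> n \<Longrightarrow> int k < \<bar>block_sum P r c k k\<bar>"
    and pb: "\<And>r c. r + p \<le> n \<Longrightarrow> c + p \<le> n \<Longrightarrow> int p < \<bar>block_sum P r c p p\<bar>"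
    and neg: "block_sum P 0 0 p p < 0"
  shows "block_sum P 0 0 n n < - int n"
proof -
  have p: "block_sum P r c p p < - int p" if "r + p \<le> n" "c + p \<le> n" for r c
    using same_sign[of p n P, OF pb neg that] by blast
  have "block_sum P 0 0 k k + int (k * k) \<le> block_sum P 0 0 p p + int (p * p)"
    using assms(2) by (intro block_sum_subblock) auto
  moreover have "p = k \<or> p = k + 1" using assms(2,3) by auto
  ultimately have "block_sum P 0 0 k k \<le> int k"
    using p[of 0 0] assms(1) by (auto simp: algebra_simps)
  then have "block_sum P 0 0 k k < 0" using kb[of 0 0] assms(1) by simp
  then have k: "block_sum P r c k k < - int k" if "r + k \<le> n" "c + k \<le> n" for r c
    using same_sign[of k n P, OF kb _ that] by blast
  have "- int ((p - k) * (p - k)) \<le> block_sum P k k (p - k) (p - k)" by (rule block_sum_ge)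
  moreover have "int ((p - k) * (p - k)) \<le> 1" using \<open>p = k \<or> p = k + 1\<close> by auto
  ultimately show ?thesis
    using quadrants[OF assms(1,2), of P] p[of 0 0] p[of k k] k[of 0 p] k[of p 0] assms(1) by simp
qed

lemma quadrant_bound:
  assumes "n = p + k" "k \<le> p" "p \<le> k + 1"
    and kb: "\<And>r c. r + k \<le> n \<Longrightarrow> c + k \<le> n \<Longrightarrow> int k < \<bar>block_sum P r c k k\<bar>"
    and pb: "\<And>r c. r + p \<le> n \<Longrightarrow> c + p \<le> n \<Longrightarrow> int p < \<bar>block_sum P r c p p\<bar>"
  shows "int n < \<bar>block_sum P 0 0 n n\<bar>"
proof (cases "block_sum P 0 0 p p < 0")
  case True
  with quadrant_bound_neg[OF assms(1-3), of P] kb pb show ?thesis by fastforce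
next
  case False
  then have "block_sum (\<lambda>i j. \<not> P i j) 0 0 p p < 0"
    using pb[of 0 0] assms(1) by (simp add: block_sum_not)
  with quadrant_bound_neg[OF assms(1-3), of "\<lambda>i j. \<not> P i j"] kb pb show ?thesis
    by (simp add: block_sum_not)
qed

lemma block_sum_2_2: "block_sum P r c 2 2 = entry (P r c) + entry (P r (c + 1)) + entry (P (r + 1) c) + entry (P (r + 1) (c + 1))"
  by (simp add: block_sum_def numeral_2_eq_2)

lemma adjacent_2_blocks:
  assumes "zero_sum_free n P" "r + 2 \<le> n" "c + 4 \<le> n"
  shows "block_sum P r c 2 2 \<noteq> 4 \<or> block_sum P r (c + 2) 2 2 \<noteq> - 4"
    and "block_sum P r c 2 2 \<noteq> - 4 \<or> block_sum P r (c + 2) 2 2 \<noteq> 4"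
  using zero_sum_freeD[OF assms(1), of 1 r "c + 1"] assms(2,3)
  by (auto simp: block_sum_2_2 entry_def zero_sum_def add.assoc split: if_splits)

lemma block_2_values:
  shows "block_sum P r c 2 2 = 4 \<or> block_sum P r c 2 2 \<le> 2"
    and "block_sum P r c 2 2 = - 4 \<or> - 2 \<le> block_sum P r c 2 2"
  by (auto simp: block_sum_2_2 entry_def)

text \<open>The four \<open>4 \<times> 4\<close> blocks overlap in the central \<open>3 \<times> 3\<close> block. If the total is at least \<open>- 5\<close>, adding
  up the four bounds leaves only one possibility: the centre is all minus, the corners are plus and
  the edges have sum at least 0. But next to an all-minus centre an edge has at most one plus.\<close>

lemma no_staircase_5:
  assumes "zero_sum_free 5 P" and four: "\<And>r c. r + 4 \<le> 5 \<Longrightarrow> c + 4 \<le> 5 \<Longrightarrow> block_sum P r c 4 4 \<le> - 8"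
  shows "block_sum P 0 0 5 5 < - 5"
proof (rule ccontr)
  assume "\<not> block_sum P 0 0 5 5 < - 5"
  let ?I = "block_sum P 1 1 3 3"
  let ?T = "block_sum P 0 1 1 3" let ?B = "block_sum P 4 1 1 3"
  let ?L = "block_sum P 1 0 3 1" let ?R = "block_sum P 1 4 3 1"
  let ?c = "\<lambda>i j. block_sum P i j 1 1"
  have "block_sum P 0 0 5 5 = ?c 0 0 + ?c 0 4 + ?c 4 0 + ?c 4 4 + ?T + ?B + ?L + ?R + ?I"
    "block_sum P 0 0 4 4 = ?c 0 0 + ?T + ?L + ?I" "block_sum P 0 1 4 4 = ?c 0 4 + ?T + ?R + ?I"
    "block_sum P 1 0 4 4 = ?c 4 0 + ?B + ?L + ?I" "block_sum P 1 1 4 4 = ?c 4 4 + ?B + ?R + ?I"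
    by (simp_all add: block_sum_def numeral_eq_Suc)
  moreover have "?c i j \<le> 1" for i j using block_sum_le[of P i j 1 1] by simp
  note this[of 0 0] this[of 0 4] this[of 4 0] this[of 4 4]
  moreover have I: "- 9 \<le> ?I" using block_sum_ge[of 3 3 P 1 1] by simp
  moreover note four[of 0 0] four[of 0 1] four[of 1 0] four[of 1 1]
  ultimately have "?I \<le> - 9" and E: "0 \<le> ?T + ?B + ?L + ?R"
    using \<open>\<not> block_sum P 0 0 5 5 < - 5\<close> by linarith+
  have centre: "\<not> P i j" if "1 \<le> i" "i \<le> 3" "1 \<le> j" "j \<le> 3" for i j
    using block_sum_min_cells[of P 1 1 3 3 "i - 1" "j - 1"] that \<open>?I \<le> - 9\<close> by simp
  have edge: "\<not> (P 0 j \<and> P 0 (j + s))" "\<not> (P 4 j \<and> P 4 (j + s))"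
    "\<not> (P j 0 \<and> P (j + s) 0)" "\<not> (P j 4 \<and> P (j + s) 4)"
    if "1 \<le> s" "1 \<le> j" "j + s \<le> 3" for j s
    using that centre[of s j] centre[of s "j + s"] centre[of "4 - s" j] centre[of "4 - s" "j + s"]
      centre[of j s] centre[of "j + s" s] centre[of j "4 - s"] centre[of "j + s" "4 - s"]
      zero_sum_freeD[OF assms(1), of s 0 j] zero_sum_freeD[OF assms(1), of s "4 - s" j]
      zero_sum_freeD[OF assms(1), of s j 0] zero_sum_freeD[OF assms(1), of s j "4 - s"]
    by (simp_all add: zero_sum_def) blast+
  have three: "entry x + entry y + entry z \<le> - 1" if "\<not> (x \<and> y)" "\<not> (y \<and> z)" "\<not> (x \<and> z)" for x y z
    using that by (cases x; cases y; cases z) (simp_all add: entry_def)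
  have "?T = entry (P 0 1) + entry (P 0 2) + entry (P 0 3)" "?B = entry (P 4 1) + entry (P 4 2) + entry (P 4 3)"
    "?L = entry (P 1 0) + entry (P 2 0) + entry (P 3 0)" "?R = entry (P 1 4) + entry (P 2 4) + entry (P 3 4)"
    by (simp_all add: block_sum_def numeral_eq_Suc)
  moreover have "entry (P 0 1) + entry (P 0 2) + entry (P 0 3) \<le> - 1"
    by (rule three) (use edge(1)[of 1 1] edge(1)[of 1 2] edge(1)[of 2 1] in \<open>simp_all add: numeral_eq_Suc\<close>)
  moreover have "entry (P 4 1) + entry (P 4 2) + entry (P 4 3) \<le> - 1"
    by (rule three) (use edge(2)[of 1 1] edge(2)[of 1 2] edge(2)[of 2 1] in \<open>simp_all add: numeral_eq_Suc\<close>)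
  moreover have "entry (P 1 0) + entry (P 2 0) + entry (P 3 0) \<le> - 1"
    by (rule three) (use edge(3)[of 1 1] edge(3)[of 1 2] edge(3)[of 2 1] in \<open>simp_all add: numeral_eq_Suc\<close>)
  moreover have "entry (P 1 4) + entry (P 2 4) + entry (P 3 4) \<le> - 1"
    by (rule three) (use edge(4)[of 1 1] edge(4)[of 1 2] edge(4)[of 2 1] in \<open>simp_all add: numeral_eq_Suc\<close>)
  ultimately have "?T \<le> - 1" "?B \<le> - 1" "?L \<le> - 1" "?R \<le> - 1" by simp_all
  with E show False by linarith
qed

text \<open>Cut the matrix into nine \<open>2 \<times> 2\<close> blocks. If the total is at least \<open>- 6\<close>, the bounds on the four aligned
  \<open>4 \<times> 4\<close> blocks force the five blocks of the central cross to be almost entirely minus. An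
  all-plus corner block would keep both of its neighbours from being all minus, so there is none, and
  the total is too small after all.\<close>

lemma no_staircase_6:
  assumes "zero_sum_free 6 P" and four: "\<And>r c. r + 4 \<le> 6 \<Longrightarrow> c + 4 \<le> 6 \<Longrightarrow> block_sum P r c 4 4 \<le> - 8"
  shows "block_sum P 0 0 6 6 < - 6"
proof (rule ccontr)
  assume big: "\<not> block_sum P 0 0 6 6 < - 6"
  define b where "b = (\<lambda>u v. block_sum P (2 * u) (2 * v) 2 2)"
  have total: "block_sum P 0 0 6 6 = b 0 0 + b 0 1 + b 0 2 + b 1 0 + b 1 1 + b 1 2 + b 2 0 + b 2 1 + b 2 2"
    by (simp add: b_def block_sum_def numeral_eq_Suc)
  have "b u v + b u (v + 1) + b (u + 1) v + b (u + 1) (v + 1) \<le> - 8" if "u < 2" "v < 2" for u v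
  proof -
    have "block_sum P (2 * u) (2 * v) (2 + 2) (2 + 2) = b u v + b u (v + 1) + b (u + 1) v + b (u + 1) (v + 1)"
      unfolding block_sum_add_rows block_sum_add_cols by (simp add: b_def)
    then show ?thesis using four[of "2 * u" "2 * v"] that by simp
  qed
  from this[of 0 0] this[of 0 1] this[of 1 0] this[of 1 1]
  have aligned: "b 0 0 + b 0 1 + b 1 0 + b 1 1 \<le> - 8" "b 0 1 + b 0 2 + b 1 1 + b 1 2 \<le> - 8"
    "b 1 0 + b 1 1 + b 2 0 + b 2 1 \<le> - 8" "b 1 1 + b 1 2 + b 2 1 + b 2 2 \<le> - 8"
    by (simp_all add: numeral_2_eq_2)
  have lower: "- 4 \<le> b u v" for u v using block_sum_ge[of 2 2 P] by (simp add: b_def)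
  have val4: "b u v = 4 \<or> b u v \<le> 2" "b u v = - 4 \<or> - 2 \<le> b u v" for u v
    using block_2_values[of P "2 * u" "2 * v"] by (auto simp: b_def)
  have horiz: "b u v \<noteq> 4 \<or> b u (v + 1) \<noteq> - 4" "b u v \<noteq> - 4 \<or> b u (v + 1) \<noteq> 4" if "u < 3" "v < 2" for u v
    using adjacent_2_blocks[OF assms(1), of "2 * u" "2 * v"] that by (auto simp: b_def)
  have vert: "b u v \<noteq> 4 \<or> b (u + 1) v \<noteq> - 4" "b u v \<noteq> - 4 \<or> b (u + 1) v \<noteq> 4" if "u < 2" "v < 3" for u v
    using adjacent_2_blocks[OF zero_sum_free_transp[OF assms(1)], of "2 * v" "2 * u"] that
    by (auto simp: b_def block_sum_transp[of P])
  \<comment> \<open>the sum of the aligned bounds minus the total counts the corners zero times, the edges once and the centre three times\<close>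
  have edges: "b 0 1 + b 1 0 + b 1 2 + b 2 1 + 3 * b 1 1 \<le> - 26"
    using aligned total big by linarith
  note low = lower[of 0 1] lower[of 1 0] lower[of 1 2] lower[of 2 1] lower[of 1 1]
  have "b 0 0 \<le> 2"
    using val4[of 0 0] val4[of 0 1] val4[of 1 0] horiz[of 0 0] vert[of 0 0] edges low by auto
  moreover have "b 0 2 \<le> 2"
    using val4[of 0 2] val4[of 0 1] val4[of 1 2] horiz[of 0 1] vert[of 0 2] edges low by (auto simp: numeral_2_eq_2)
  moreover have "b 2 0 \<le> 2"
    using val4[of 2 0] val4[of 1 0] val4[of 2 1] horiz[of 2 0] vert[of 1 0] edges low by (auto simp: numeral_2_eq_2)
  moreover have "b 2 2 \<le> 2"
    using val4[of 2 2] val4[of 1 2] val4[of 2 1] horiz[of 2 1] vert[of 1 2] edges low by (auto simp: numeral_2_eq_2)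
  ultimately show False using edges low total big by linarith
qed

lemma no_staircase_7:
  assumes four: "\<And>r c. r + 4 \<le> 7 \<Longrightarrow> c + 4 \<le> 7 \<Longrightarrow> block_sum P r c 4 4 \<le> - 8"
  shows "block_sum P 0 0 7 7 < - 7"
proof -
  have "block_sum P 0 4 3 3 + int (3 * 3) \<le> block_sum P 0 3 4 4 + int (4 * 4)"
    "block_sum P 4 0 3 3 + int (3 * 3) \<le> block_sum P 3 0 4 4 + int (4 * 4)"
    by (rule block_sum_subblock; simp)+
  moreover have "- int (1 * 1) \<le> block_sum P 3 3 1 1" by (rule block_sum_ge)
  moreover have "block_sum P 0 0 7 7 = block_sum P 0 0 4 4 + block_sum P 3 3 4 4
     + block_sum P 0 4 3 3 + block_sum P 4 0 3 3 - block_sum P 3 3 1 1"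
    using quadrants[of 7 4 3 P] by simp
  ultimately show ?thesis using four[of 0 0] four[of 3 3] four[of 0 3] four[of 3 0] by simp
qed

lemma no_staircase_small:
  assumes "zero_sum_free n P" "n = 5 \<or> n = 6 \<or> n = 7"
    and four: "\<And>r c. r + 4 \<le> n \<Longrightarrow> c + 4 \<le> n \<Longrightarrow> 8 \<le> \<bar>block_sum P r c 4 4\<bar>"
  shows "int n < \<bar>block_sum P 0 0 n n\<bar>"
proof -
  have neg: "block_sum Q 0 0 n n < - int n"
    if "zero_sum_free n Q" "\<And>r c. r + 4 \<le> n \<Longrightarrow> c + 4 \<le> n \<Longrightarrow> 8 \<le> \<bar>block_sum Q r c 4 4\<bar>"
      "block_sum Q 0 0 4 4 < 0" for Q
  proof -
    have "block_sum Q r c 4 4 \<le> - 8" if "r + 4 \<le> n" "c + 4 \<le> n" for r c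
    proof -
      have "block_sum Q r c 4 4 < - int 4"
        using \<open>block_sum Q 0 0 4 4 < 0\<close> that
        by (intro same_sign[of 4 n Q]) (use \<open>\<And>r c. r + 4 \<le> n \<Longrightarrow> c + 4 \<le> n \<Longrightarrow> 8 \<le> \<bar>block_sum Q r c 4 4\<bar>\<close> in fastforce)+
      with \<open>\<And>r c. r + 4 \<le> n \<Longrightarrow> c + 4 \<le> n \<Longrightarrow> 8 \<le> \<bar>block_sum Q r c 4 4\<bar>\<close>[OF that] show ?thesis by simp
    qed
    then show ?thesis
      using assms(2) no_staircase_5[of Q] no_staircase_6[of Q] no_staircase_7[of Q] \<open>zero_sum_free n Q\<close> by auto
  qed
  show ?thesis
  proof (cases "block_sum P 0 0 4 4 < 0")
    case True
    then show ?thesis using neg[OF assms(1) four] by linarith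
  next
    case False
    have "symm n P (\<lambda>i j. \<not> P i j)"
      unfolding symm_def by (rule exI[of _ True], rule exI[of _ False], rule exI[of _ False]) (simp add: flip_def)
    then have "zero_sum_free n (\<lambda>i j. \<not> P i j)" by (rule zero_sum_free_symm[OF assms(1)])
    moreover have "0 < block_sum P 0 0 4 4" using False four[of 0 0] assms(2) by auto
    ultimately show ?thesis
      using neg[of "\<lambda>i j. \<not> P i j"] four by (simp add: block_sum_not)
  qed
qed

section \<open>Matrices with a staircase in the corner\<close>

text \<open>The triangle lemmas reach one line further than \<open>triangle_forced\<close> if one cell of that line is left
  open on either side.\<close>

lemma corner_region:
  assumes "zero_sum_free n P" "plus_corner P 0 0 (t + 1)" "3 \<le> t" "t < n"
    and "i \<le> t + t div 2" "j \<le> t + t div 2" "i < n" "j < n"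
    and "(i, j) \<noteq> (t div 2, t + t div 2)" "(i, j) \<noteq> (t + t div 2, t div 2)"
  shows "P i j \<longleftrightarrow> i + j < t"
proof -
  define q where "q = t + t div 2"
  have q: "t < q" using assms(3) by (simp add: q_def)
  have tri: "triangle P t m" if "t < m" "m \<le> n" "m \<le> q" for m
    using triangle_forced[OF assms(1-3)] that by (simp add: q_def)
  show ?thesis
  proof (cases "i < q \<and> j < q")
    case True
    then have "triangle P t (min n q)" using tri assms(4) q by simp
    then show ?thesis using True assms(7,8) unfolding triangle_def by simp
  next
    case False
    then have qn: "q < n" and t: "triangle P t q" using assms(5-8) tri[of q] q by (auto simp: q_def)
    have split: "q + 1 - t \<le> k \<or> k < t div 2" if "k \<noteq> t div 2" for k
      using that unfolding q_def by linarith
    have col: "\<not> P k q" if "k < q" "k \<noteq> t div 2" for k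
      by (rule triangle_next_column[OF assms(1) t assms(3) q qn that(1) split[OF that(2)]])
    have row: "\<not> P q k" if "k < q" "k \<noteq> t div 2" for k
      using triangle_next_column[OF zero_sum_free_transp[OF assms(1)], of t q k] t assms(3) q qn that(1) split[OF that(2)]
      by (simp add: triangle_transp[of P])
    have "\<not> P q q" by (rule triangle_next_corner[OF assms(1) t assms(3) q qn])
    with col row False assms(5,6,9,10) q show ?thesis
      by (cases "i = q"; cases "j = q") (auto simp: q_def[symmetric])
  qed
qed

lemma corner_sum:
  assumes "zero_sum_free n P" "plus_corner P 0 0 (t + 1)" "3 \<le> t" "t < m" "m \<le> n" "m \<le> t + t div 2 + 1"
  shows "block_sum P 0 0 m m \<le> int t * (int t + 1) - int m * int m + 4"
proof (cases "m \<le> t + t div 2")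
  case True
  then have "triangle P t m" using triangle_forced[OF assms(1-5)] by simp
  then have "block_sum P 0 0 m m = int t * (int t + 1) - int m * int m"
    using assms(4) by (intro block_sum_triangle) (auto simp: triangle_def)
  then show ?thesis by simp
next
  case False
  define q where "q = t + t div 2"
  have m: "m = q + 1" and q: "t < q" using False assms(3,6) by (auto simp: q_def)
  note region = corner_region[OF assms(1-3), folded q_def]
  have "triangle P t q" using triangle_forced[OF assms(1-3) q] m assms(5) by (simp add: q_def)
  then have "block_sum P 0 0 q q = int t * (int t + 1) - int q * int q"
    using q by (intro block_sum_triangle) (auto simp: triangle_def)
  moreover have "block_sum P 0 q q 1 \<le> 2 - int (q * 1)"
  proof (rule block_sum_one_stray[where u = "t div 2" and v = 0])
    fix i j assume "i < q" "j < (1::nat)" "(i, j) \<noteq> (t div 2, 0)"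
    then show "\<not> P (0 + i) (q + j)"
      using region[of i q] m q assms(3,5) by auto
  qed
  moreover have "block_sum P q 0 1 q \<le> 2 - int (1 * q)"
  proof (rule block_sum_one_stray[where u = 0 and v = "t div 2"])
    fix i j assume "i < (1::nat)" "j < q" "(i, j) \<noteq> (0, t div 2)"
    then show "\<not> P (q + i) (0 + j)"
      using region[of q j] m q assms(3,5) by auto
  qed
  moreover have "block_sum P q q 1 1 = - 1"
    using region[of q q] m q assms(3,5) by (simp add: block_sum_def entry_def q_def)
  moreover have "block_sum P 0 0 m m = block_sum P 0 0 q q + block_sum P 0 q q 1 + block_sum P q 0 1 q + block_sum P q q 1 1"
    unfolding m by (simp only: block_sum_add_rows block_sum_add_cols add_0_left)
  ultimately show ?thesis unfolding m by (simp add: algebra_simps)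
qed

text \<open>The first \<open>(p - 1) div 2\<close> columns to the right of the plus corner are all minus except for one
  cell; the trivial bound is good enough for the others.\<close>

lemma beside_corner:
  assumes "zero_sum_free n P" "plus_corner P 0 0 p" "4 \<le> p" "n = p + r" "(p - 1) div 2 < r"
  shows "block_sum P 0 p p r \<le> 2 - int p * (2 * int ((p - 1) div 2) - int r)"
proof -
  define t where "t = p - 1"
  define h where "h = t div 2"
  have p: "p = t + 1" "3 \<le> t" using assms(3) by (auto simp: t_def)
  have h: "1 \<le> h" "h < r" using p assms(5) by (auto simp: h_def)
  note region = corner_region[OF assms(1) assms(2)[unfolded p(1)] p(2), folded h_def]
  have "block_sum P 0 p p h \<le> 2 - int (p * h)"
  proof (rule block_sum_one_stray[where u = h and v = "h - 1"])
    fix i j assume ij: "i < p" "j < h" "(i, j) \<noteq> (h, h - 1)"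
    have "P i (p + j) \<longleftrightarrow> i + (p + j) < t"
    proof (rule region)
      show "(i, p + j) \<noteq> (h, t + h)" using ij p by auto
    qed (use ij p h assms(4) in \<open>auto simp: h_def\<close>)
    then show "\<not> P (0 + i) (p + j)" using p(1) by simp
  qed
  moreover have "block_sum P 0 (p + h) p (r - h) \<le> int (p * (r - h))" by (rule block_sum_le)
  moreover have "block_sum P 0 p p r = block_sum P 0 p p h + block_sum P 0 (p + h) p (r - h)"
    using block_sum_add_cols[of P 0 p p h "r - h"] h by simp
  moreover have "int (p * (r - h)) = int p * (int r - int h)" using h by (simp add: of_nat_diff)
  ultimately have "block_sum P 0 p p r \<le> 2 - int p * (2 * int h - int r)" by (simp add: algebra_simps)
  then show ?thesis by (simp add: h_def t_def)
qed

text \<open>The statement proved by strong induction on \<open>m\<close>.\<close>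

definition dichotomy :: "nat \<Rightarrow> bool" where
  "dichotomy m \<longleftrightarrow> (\<forall>P. zero_sum_free m P \<longrightarrow> staircase P 0 0 m \<or> int m < \<bar>block_sum P 0 0 m m\<bar>)"

text \<open>Side 4 is included, although the dichotomy itself fails for \<open>4 \<times> 4\<close> matrices: it holds for blocks of
  larger matrices by \<open>four_block\<close>.\<close>

lemma block_dichotomy:
  assumes "zero_sum_free n P" "5 \<le> n" "\<And>m. 5 \<le> m \<Longrightarrow> m < n \<Longrightarrow> dichotomy m"
    and "4 \<le> m" "m < n" "r + m \<le> n" "c + m \<le> n"
  shows "staircase P r c m \<or> int m < \<bar>block_sum P r c m m\<bar>"
proof (cases "m = 4")
  case True
  then show ?thesis using four_block[OF assms(1,2), of r c] assms(6,7) by auto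
next
  case False
  then have "dichotomy m" using assms(3-5) by simp
  then have "staircase (shifted r c P) 0 0 m \<or> int m < \<bar>block_sum (shifted r c P) 0 0 m m\<bar>"
    using zero_sum_free_shift[OF assms(1,6,7)] unfolding dichotomy_def by blast
  then show ?thesis unfolding staircase_shift block_sum_shift add_0_right .
qed

text \<open>Here \<open>n\<close> is so small compared with \<open>p\<close> that the rectangles beside and below the corner block are
  mostly minus. The remaining square in the bottom right corner starts with a long stretch of minus
  signs on the main diagonal; a staircase with a plus majority would conflict with it, so the nested
  squares from side \<open>p\<close> down to side \<open>r\<close> stay negative.\<close>

lemma large_corner_gap:
  assumes sf: "zero_sum_free n P" and cor: "plus_corner P 0 0 p" and "5 \<le> p"
    and dich: "\<And>m r c. 4 \<le> m \<Longrightarrow> m < n \<Longrightarrow> r + m \<le> n \<Longrightarrow> c + m \<le> n \<Longrightarrow>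
      staircase P r c m \<or> int m < \<bar>block_sum P r c m m\<bar>"
    and pneg: "\<And>r c. r + p \<le> n \<Longrightarrow> c + p \<le> n \<Longrightarrow> block_sum P r c p p \<le> - int p"
    and n: "n = p + r" "(p - 1) div 2 < r" "r < 2 * ((p - 1) div 2)"
  shows "block_sum P 0 0 n n < - int n"
proof -
  define t where "t = p - 1"
  define h where "h = t div 2"
  have p: "p = t + 1" "4 \<le> t" using assms(3) by (auto simp: t_def)
  have h: "2 \<le> h" "h < r" "r < 2 * h" "2 * h \<le> t" using p n by (auto simp: h_def)
  have pred: "(p - 1) div 2 = h" by (simp add: h_def t_def)
  define q where "q = t + h"
  have q: "q < n" using n p h by (simp add: q_def)
  have t3: "3 \<le> t" using p by simp
  note region = corner_region[OF sf cor[unfolded p(1)] t3, folded h_def]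
  have minus: "\<not> P i j" if "p \<le> i" "p \<le> j" "i \<le> q" "j \<le> q" for i j
  proof -
    have "P i j \<longleftrightarrow> i + j < t"
      by (rule region) (use that p h q in \<open>auto simp: q_def\<close>)
    then show ?thesis using that p by simp
  qed
  have beside: "block_sum P 0 p p r \<le> 2 - int p"
    and below: "block_sum P p 0 r p \<le> 2 - int p"
  proof -
    have "int p * 1 \<le> int p * (2 * int h - int r)" using h by (intro mult_left_mono) auto
    then have le: "2 - int p * (2 * int h - int r) \<le> 2 - int p" by simp
    have p4: "4 \<le> p" using assms(3) by simp
    show "block_sum P 0 p p r \<le> 2 - int p"
      using beside_corner[OF sf cor p4 n(1,2), unfolded pred] le by (rule order_trans)
    have "plus_corner (transposed P) 0 0 p" using cor by (simp add: plus_corner_transp[of P])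
    from beside_corner[OF zero_sum_free_transp[OF sf] this p4 n(1,2), unfolded pred] le
    show "block_sum P p 0 r p \<le> 2 - int p"
      unfolding block_sum_transp[of P] by (rule order_trans)
  qed
  have "triangle P t p" using cor p unfolding triangle_def plus_corner_def by auto
  then have "block_sum P 0 0 p p = int t * (int t + 1) - int p * int p"
    using p by (intro block_sum_triangle) (auto simp: triangle_def)
  then have nw: "block_sum P 0 0 p p = - int p" unfolding p(1) by (simp add: algebra_simps)
  have total: "block_sum P 0 0 n n = block_sum P 0 0 p p + block_sum P 0 p p r + block_sum P p 0 r p + block_sum P p p r r"
    unfolding n(1) by (simp only: block_sum_add_rows block_sum_add_cols add_0_left)
  show ?thesis
  proof (cases "4 \<le> r")
    case False
    then have "r = 3" "h = 2" using h by auto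
    have "block_sum P p p h h = - int (h * h)"
      by (rule block_sum_all_minus, rule minus) (use p in \<open>auto simp: q_def\<close>)
    moreover have "block_sum P p p r r - int (r * r) \<le> block_sum P p p h h - int (h * h)"
      using h by (intro block_sum_subblock_le) auto
    ultimately have "block_sum P p p r r \<le> 1" using \<open>r = 3\<close> \<open>h = 2\<close> by simp
    then show ?thesis using total nw beside below p(2) n(1) \<open>r = 3\<close> p(1) by simp
  next
    case True
    have "block_sum P (n - r) (n - r) r r \<le> - int r"
    proof (rule nested_blocks[where p = p])
      show "r \<le> p" using h p by simp
      show "block_sum P (n - p) (n - p) p p \<le> - int p" using n by (intro pneg) auto
      fix m assume m: "r \<le> m" "m < p"
      show "n - Suc m \<le> n - m \<and> n - m \<le> Suc (n - Suc m) \<and> n - Suc m \<le> n - m \<and> n - m \<le> Suc (n - Suc m)"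
        by auto
      define s where "s = n - m"
      have s: "s + m = n" "s \<le> p" "s \<le> q" "h + 1 < s" using m n p h by (auto simp: s_def q_def)
      have d: "staircase P s s m \<or> int m < \<bar>block_sum P s s m m\<bar>"
        using dich[of m s s] True m s n h by simp
      have "block_sum P s s m m \<noteq> int m"
      proof
        assume plus: "block_sum P s s m m = int m"
        with d have st: "staircase P s s m" by simp
        have "P s s \<longleftrightarrow> s + s < t"
          by (rule region) (use s q h p in \<open>auto simp: q_def\<close>)
        then have ss: "\<not> P (s + 0) (s + 0)" using s h by (simp add: h_def)
        have qq: "\<not> P (s + (q - s)) (s + (q - s))" using minus[of q q] s p h by (simp add: q_def)
        have lt: "0 < m" "q - s < m" using m True q s by auto
        \<comment> \<open>the minus cell \<open>(q, q)\<close> lies on the far side of the antidiagonal of the block\<close>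
        have far: "m \<le> (q - s) + (q - s) + 1" "0 + 0 + 1 \<le> m" "0 \<le> (0::nat)"
          using s m n p h lt by (simp_all add: q_def)
        from staircase_plus_cells[OF st plus lt(1)] show False
          using ss qq lt far by blast
      qed
      moreover have "int m \<le> \<bar>block_sum P s s m m\<bar>" using d staircase_sum[of P s s m] True m by auto
      ultimately show "int m \<le> \<bar>block_sum P (n - m) (n - m) m m\<bar> \<and> block_sum P (n - m) (n - m) m m \<noteq> int m"
        by (simp add: s_def)
    qed
    then have "block_sum P p p r r \<le> - int r" using n by simp
    then show ?thesis using total nw beside below n(1) p h by simp
  qed
qed

text \<open>Every square block of side \<open>m\<close> with \<open>r \<le> m < p\<close> in the top right corner of the matrix contains a full
  column from the minus region, but a staircase with a plus majority has a plus sign in each column.\<close>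

lemma off_diagonal_block:
  assumes sf: "zero_sum_free n P" and cor: "plus_corner P 0 0 p" and "5 \<le> p"
    and dich: "\<And>m r c. 4 \<le> m \<Longrightarrow> m < n \<Longrightarrow> r + m \<le> n \<Longrightarrow> c + m \<le> n \<Longrightarrow>
      staircase P r c m \<or> int m < \<bar>block_sum P r c m m\<bar>"
    and pneg: "\<And>r c. r + p \<le> n \<Longrightarrow> c + p \<le> n \<Longrightarrow> block_sum P r c p p \<le> - int p"
    and n: "n = p + r" "4 \<le> r" "r \<le> p"
  shows "block_sum P 0 p r r \<le> - int r"
proof -
  define t where "t = p - 1"
  define h where "h = t div 2"
  have p: "p = t + 1" "4 \<le> t" using assms(3) by (auto simp: t_def)
  have h: "2 \<le> h" using p by (auto simp: h_def)
  have t3: "3 \<le> t" using p by simp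
  note region = corner_region[OF sf cor[unfolded p(1)] t3, folded h_def]
  have minus: "\<not> P i j" if "i < p" "j = t \<or> j = p" "t \<le> i + j" for i j
  proof -
    have "P i j \<longleftrightarrow> i + j < t"
      by (rule region) (use that p h n in auto)
    then show ?thesis using that p by simp
  qed
  have "block_sum P 0 (n - r) r r \<le> - int r"
  proof (rule nested_blocks[where p = p and a = "\<lambda>_. 0" and b = "\<lambda>m. n - m"])
    show "r \<le> p" by (rule n(3))
    show "block_sum P 0 (n - p) p p \<le> - int p" using n by (intro pneg) auto
    fix m assume m: "r \<le> m" "m < p"
    show "0 \<le> (0::nat) \<and> 0 \<le> Suc (0::nat) \<and> n - Suc m \<le> n - m \<and> n - m \<le> Suc (n - Suc m)"
      by auto
    define s where "s = n - m"
    have s: "s + m = n" "s \<le> p" using m n by (auto simp: s_def)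
    \<comment> \<open>column \<open>u\<close> of the block is column \<open>t\<close> of the matrix, or column \<open>p\<close> if the block starts there\<close>
    define u where "u = (if s \<le> t then t - s else 0)"
    have su: "s + u = t \<or> s + u = p" "u < m" using s p m n by (auto simp: u_def)
    have d: "staircase P 0 s m \<or> int m < \<bar>block_sum P 0 s m m\<bar>"
      using dich[of m 0 s] m s n by simp
    have "block_sum P 0 s m m \<noteq> int m"
    proof
      assume plus: "block_sum P 0 s m m = int m"
      with d have st: "staircase P 0 s m" by simp
      have col: "\<not> P (0 + i) (s + u)" if "i < m" for i
        using minus[of i "s + u"] su that m p by auto
      have "0 < m" using m n by simp
      from staircase_plus_cells[OF st plus this] show False
      proof (elim disjE)
        assume "\<forall>i<m. \<forall>j<m. m \<le> i + j + 1 \<longrightarrow> P (0 + i) (s + j)"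
        then show False using col[of "m - 1 - u"] su \<open>0 < m\<close> by auto
      next
        assume "\<forall>i<m. \<forall>j<m. i + j + 1 \<le> m \<longrightarrow> P (0 + i) (s + j)"
        then show False using col[of "m - 1 - u"] su \<open>0 < m\<close> by auto
      next
        assume "\<forall>i<m. \<forall>j<m. i \<le> j \<longrightarrow> P (0 + i) (s + j)"
        then show False using col[of u] su by auto
      next
        assume "\<forall>i<m. \<forall>j<m. j \<le> i \<longrightarrow> P (0 + i) (s + j)"
        then show False using col[of u] su by auto
      qed
    qed
    moreover have "int m \<le> \<bar>block_sum P 0 s m m\<bar>" using d staircase_sum[of P 0 s m] m n by auto
    ultimately show "int m \<le> \<bar>block_sum P 0 (n - m) m m\<bar> \<and> block_sum P 0 (n - m) m m \<noteq> int m"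
      by (simp add: s_def)
  qed
  then show ?thesis using n by simp
qed

section \<open>The dichotomy\<close>

text \<open>The squares of a \<open>6 \<times> 6\<close> matrix with \<open>plus_corner P 0 0 4\<close> that meet the last row or the last column;
  \<open>y0\<close> to \<open>y4\<close> are the entries of the last column, \<open>z0\<close> to \<open>z4\<close> those of the last row, \<open>w\<close> is the
  entry in the corner, and \<open>a\<close>, \<open>b\<close> are the two cells left open by \<open>corner_region\<close>.\<close>

lemma last_column_of_6:
  fixes a b y0 y1 y2 y3 y4 z0 z1 z2 z3 z4 w :: bool
  assumes
    "\<not> zero_sum False y0 a y1" "\<not> zero_sum a y1 False y2" "\<not> zero_sum False y2 False y3"
    "\<not> zero_sum False y3 False y4" "\<not> zero_sum False y4 z4 w"
    "\<not> zero_sum False y0 False y2" "\<not> zero_sum False y1 False y3" "\<not> zero_sum False y2 False y4"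
    "\<not> zero_sum False y3 z3 w"
    "\<not> zero_sum True y0 False y3" "\<not> zero_sum False y1 False y4" "\<not> zero_sum False y2 z2 w"
    "\<not> zero_sum True y0 b y4" "\<not> zero_sum True y1 z1 w" "\<not> zero_sum True y0 z0 w"
    "\<not> zero_sum False b z0 z1" "\<not> zero_sum b False z1 z2" "\<not> zero_sum False False z2 z3"
    "\<not> zero_sum False False z3 z4"
    "\<not> zero_sum False False z0 z2" "\<not> zero_sum False False z1 z3" "\<not> zero_sum False False z2 z4"
    "\<not> zero_sum True False z0 z3" "\<not> zero_sum False False z1 z4"
    "\<not> zero_sum True a z0 z4"
  shows "\<not> (a \<and> y0) \<and> \<not> (a \<and> y1) \<and> \<not> (y0 \<and> y1)"
  using assms unfolding zero_sum_def by argo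

lemma corner_staircase: "plus_corner P r c m \<Longrightarrow> staircase P r c m"
  unfolding plus_corner_def staircase_def
  by (rule exI[of _ False], rule exI[of _ False], rule exI[of _ False]) (simp add: flip_def)

lemma corner_4_in_6:
  assumes sf: "zero_sum_free 6 P" and cor: "plus_corner P 0 0 4"
  shows "block_sum P 0 4 2 2 \<le> - 2"
proof -
  have region: "P i j \<longleftrightarrow> i + j < 3" if "i \<le> 4" "j \<le> 4" "(i, j) \<noteq> (1, 4)" "(i, j) \<noteq> (4, 1)" for i j
    using corner_region[OF sf, of 3 i j] cor that by simp
  have sq: "\<not> zero_sum (P i j) (P i (j + s)) (P (i + s) j) (P (i + s) (j + s))"
    if "0 < s" "i + s < 6" "j + s < 6" for s i j
    using zero_sum_freeD[OF sf that] .
  have "\<not> (P 1 4 \<and> P 0 5) \<and> \<not> (P 1 4 \<and> P 1 5) \<and> \<not> (P 0 5 \<and> P 1 5)"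
    by (rule last_column_of_6[of "P 0 5" "P 1 4" "P 1 5" "P 2 5" "P 3 5" "P 4 5" "P 5 4" "P 5 5" "P 5 3" "P 5 2"
          "P 4 1" "P 5 1" "P 5 0"])
      (use sq[of 1 0 4] sq[of 1 1 4] sq[of 1 2 4] sq[of 1 3 4] sq[of 1 4 4] sq[of 2 0 3] sq[of 2 1 3] sq[of 2 2 3]
        sq[of 2 3 3] sq[of 3 0 2] sq[of 3 1 2] sq[of 3 2 2] sq[of 4 0 1] sq[of 4 1 1] sq[of 5 0 0]
        sq[of 1 4 0] sq[of 1 4 1] sq[of 1 4 2] sq[of 1 4 3] sq[of 2 3 0] sq[of 2 3 1] sq[of 2 3 2]
        sq[of 3 2 0] sq[of 3 2 1] sq[of 4 1 0] region in \<open>simp_all add: numeral_eq_Suc\<close>)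
  moreover have "\<not> P 0 4" using region[of 0 4] by simp
  ultimately show ?thesis by (auto simp: block_sum_2_2 entry_def)
qed

text \<open>The entries forced by the corner exclude all staircases from the block at \<open>(0, 3)\<close>, so its sum is
  at most \<open>- 8\<close>.\<close>

lemma corner_4_in_7:
  assumes sf: "zero_sum_free 7 P" and cor: "plus_corner P 0 0 4"
    and neg: "block_sum P 0 3 4 4 \<le> - 4"
  shows "block_sum P 0 4 3 3 \<le> - 1"
proof -
  have region: "P i j \<longleftrightarrow> i + j < 3" if "i \<le> 4" "j \<le> 4" "(i, j) \<noteq> (1, 4)" "(i, j) \<noteq> (4, 1)" for i j
    using corner_region[OF sf, of 3 i j] cor that by simp
  have "\<not> staircase P 0 3 4"
  proof
    assume "staircase P 0 3 4"
    then obtain e f g where st: "\<And>i j. i < 4 \<Longrightarrow> j < 4 \<Longrightarrow>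
        P (0 + i) (3 + j) = (e \<noteq> (flip 4 f i + flip 4 g j + 2 \<le> 4))"
      unfolding staircase_def by blast
    have "\<not> P 0 3" "\<not> P 3 3" "\<not> P 0 4" "\<not> P 3 4"
      using region[of 0 3] region[of 3 3] region[of 0 4] region[of 3 4] by simp_all
    then show False
      using st[of 0 0] st[of 3 0] st[of 0 1] st[of 3 1]
      by (cases e; cases f; cases g) (simp_all add: flip_def)
  qed
  then have "block_sum P 0 3 4 4 \<le> - 8"
    using four_block[OF sf, of 0 3] neg by auto
  moreover have "block_sum P 0 4 3 3 + int (3 * 3) \<le> block_sum P 0 3 4 4 + int (4 * 4)"
    by (rule block_sum_subblock) auto
  ultimately show ?thesis by simp
qed

lemma staircase_transp:
  assumes "staircase P c r m"
  shows "staircase (transposed P) r c m"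
proof -
  obtain e f g where "\<forall>i<m. \<forall>j<m. P (c + i) (r + j) = (e \<noteq> (flip m f i + flip m g j + 2 \<le> m))"
    using assms unfolding staircase_def by blast
  then have "\<forall>i<m. \<forall>j<m. P (c + j) (r + i) = (e \<noteq> (flip m g i + flip m f j + 2 \<le> m))"
    by (simp add: add.commute)
  then show ?thesis unfolding staircase_def by blast
qed

text \<open>The case of a largest staircase of side \<open>p\<close>, in normal form and in the corner. Since all larger blocks
  are free of staircases, they are negative like the one at the corner, and this carries over to all
  blocks of side \<open>p\<close>. Beyond the range where the entries are forced, \<open>large_corner_gap\<close> applies as long
  as \<open>n < p + 2 * ((p - 1) div 2)\<close>, and the cover by four squares from there on.\<close>

lemma corner_gap:
  assumes sf: "zero_sum_free n P" and cor: "plus_corner P 0 0 p" and p: "4 \<le> p" "p < n" "n \<le> 2 * p + 1"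
    and dich: "\<And>m r c. 4 \<le> m \<Longrightarrow> m < n \<Longrightarrow> r + m \<le> n \<Longrightarrow> c + m \<le> n \<Longrightarrow>
      staircase P r c m \<or> int m < \<bar>block_sum P r c m m\<bar>"
    and max: "\<And>m r c. p < m \<Longrightarrow> m < n \<Longrightarrow> r + m \<le> n \<Longrightarrow> c + m \<le> n \<Longrightarrow> \<not> staircase P r c m"
  shows "block_sum P 0 0 n n < - int n"
proof -
  define t where "t = p - 1"
  define h where "h = t div 2"
  have t: "p = t + 1" "3 \<le> t" and h: "1 \<le> h" "2 * h \<le> t" "t \<le> 2 * h + 1"
    using p(1) by (auto simp: t_def h_def)
  note sum = corner_sum[OF sf cor[unfolded t(1)] t(2), folded h_def]
  show ?thesis
  proof (cases "n \<le> t + h + 1")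
    case True
    have "block_sum P 0 0 n n \<le> int t * (int t + 1) - int n * int n + 4"
      using sum[of n] True t p by simp
    moreover have "int t * (int t + 1) \<le> (int n - 2) * (int n - 1)"
      using p t by (intro mult_mono) auto
    ultimately show ?thesis using p by (simp add: algebra_simps)
  next
    case False
    define r where "r = n - p"
    have r: "n = p + r" "h < r" "r \<le> p + 1" using False p t by (auto simp: r_def)
    have p1: "block_sum P a c (p + 1) (p + 1) < - int (p + 1)" if "a + (p + 1) \<le> n" "c + (p + 1) \<le> n" for a c
    proof (rule same_sign[OF _ _ that])
      have "block_sum P 0 0 (p + 1) (p + 1) \<le> int t * (int t + 1) - int (p + 1) * int (p + 1) + 4"
        using sum[of "p + 1"] t h r by simp
      then show "block_sum P 0 0 (p + 1) (p + 1) < 0" using t by (simp add: algebra_simps)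
      show "int (p + 1) < \<bar>block_sum P a c (p + 1) (p + 1)\<bar>" if "a + (p + 1) \<le> n" "c + (p + 1) \<le> n" for a c
        using dich[of "p + 1" a c] max[of "p + 1" a c] that p r h by auto
    qed
    have pneg: "block_sum P a c p p \<le> - int p" if fits: "a + p \<le> n" "c + p \<le> n" for a c
    proof -
      define a' where "a' = (if a + p < n then a else a - 1)"
      define c' where "c' = (if c + p < n then c else c - 1)"
      have "block_sum P a c p p + int (p * p) \<le> block_sum P a' c' (p + 1) (p + 1) + int ((p + 1) * (p + 1))"
        using fits r h by (intro block_sum_subblock) (auto simp: a'_def c'_def)
      moreover have "block_sum P a' c' (p + 1) (p + 1) < - int (p + 1)"
        using fits r h by (intro p1) (auto simp: a'_def c'_def)
      ultimately have "block_sum P a c p p < int p" by (simp add: algebra_simps)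
      moreover have "int p \<le> \<bar>block_sum P a c p p\<bar>"
        using dich[OF p(1,2) fits] staircase_sum[of P a c p] p by auto
      ultimately show ?thesis by linarith
    qed
    have sfT: "zero_sum_free n (transposed P)" by (rule zero_sum_free_transp[OF sf])
    have corT: "plus_corner (transposed P) 0 0 p" using cor by (simp add: plus_corner_transp[of P])
    have pnegT: "block_sum (transposed P) a c p p \<le> - int p" if "a + p \<le> n" "c + p \<le> n" for a c
      using pneg[OF that(2,1)] by (simp add: block_sum_transp[of P])
    have pred: "(p - 1) div 2 = h" by (simp add: h_def t_def)
    show ?thesis
    proof (cases "r < 2 * h")
      case True
      then have "5 \<le> p" using h t r by auto
      show ?thesis
        by (rule large_corner_gap[OF sf cor \<open>5 \<le> p\<close> dich pneg r(1)]) (use True r pred in auto)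
    next
      case False
      show ?thesis
      proof (cases "r = p + 1")
        case True
        have "n = (p + 1) + p" using r True by simp
        have "- int (1 * 1) \<le> block_sum P p p 1 1" by (rule block_sum_ge)
        then show ?thesis
          using quadrants[OF \<open>n = (p + 1) + p\<close>, of P] p1[of 0 0] p1[of p p] pneg[of 0 "p + 1"] pneg[of "p + 1" 0] \<open>n = (p + 1) + p\<close>
          by simp
      next
        case False
        then have rp: "r \<le> p" using r by simp
        define d where "d = p - r"
        have d: "d \<le> 2" "p = r + d" using \<open>\<not> r < 2 * h\<close> rp h t by (auto simp: d_def)
        have quad: "block_sum P 0 0 n n = block_sum P 0 0 p p + block_sum P r r p p
          + block_sum P 0 p r r + block_sum P p 0 r r - block_sum P r r d d"
          using quadrants[OF r(1) rp, of P] by (simp add: d_def)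
        have nw: "block_sum P 0 0 p p \<le> - int p" "block_sum P r r p p \<le> - int p"
          using pneg r by simp_all
        have centre: "- int (d * d) \<le> block_sum P r r d d" by (rule block_sum_ge)
        \<comment> \<open>for \<open>r < 4\<close> there is no dichotomy for the off-diagonal blocks, but this only happens for \<open>p = 4\<close>\<close>
        have "4 \<le> r \<and> r = p \<or> 4 \<le> r \<and> r < p \<and> 5 \<le> p \<or> p = 4 \<and> r = 2 \<or> p = 4 \<and> r = 3"
          using rp \<open>\<not> r < 2 * h\<close> h t by presburger
        then consider "4 \<le> r" "r = p" | "4 \<le> r" "r < p" "5 \<le> p" | "p = 4" "r = 2" | "p = 4" "r = 3"
          by blast
        then show ?thesis
        proof cases
          case 1
          have "block_sum P 0 p r r \<le> - int p" "block_sum P p 0 r r \<le> - int p"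
            using pneg[of 0 p] pneg[of p 0] 1(2) r(1) by simp_all
          moreover have "int (d * d) = 0" using 1(2) by (simp add: d_def)
          moreover have "int n = int p + int r" "0 < int p" "r = p" using r(1) p 1 by simp_all
          ultimately show ?thesis using quad nw centre by linarith
        next
          case 2
          have dT: "staircase (transposed P) a c m \<or> int m < \<bar>block_sum (transposed P) a c m m\<bar>"
            if "4 \<le> m" "m < n" "a + m \<le> n" "c + m \<le> n" for m a c
            using dich[OF that(1,2,4,3)] staircase_transp[of P c a m] unfolding block_sum_transp[of P] by blast
          have "block_sum P 0 p r r \<le> - int r"
            by (rule off_diagonal_block[OF sf cor 2(3) dich pneg r(1) 2(1) rp])
          moreover have "block_sum P p 0 r r \<le> - int r"
            using off_diagonal_block[OF sfT corT 2(3) dT pnegT r(1) 2(1) rp] by (simp only: block_sum_transp[of P])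
          moreover have "int (d * d) \<le> 4"
            using of_nat_mono[OF mult_le_mono[OF d(1) d(1)], where 'a = int] by linarith
          moreover have "int n = int p + int r" "4 \<le> int r" "5 \<le> int p" using r(1) 2 by simp_all
          ultimately show ?thesis using quad nw centre by linarith
        next
          case 3
          then have "n = 6" "d = 2" using r d by auto
          have "block_sum P 2 2 2 2 = - 4"
            using cor 3 unfolding plus_corner_def by (simp add: block_sum_2_2 entry_def)
          moreover have "block_sum P 0 4 2 2 \<le> - 2" "block_sum P 4 0 2 2 \<le> - 2"
            using corner_4_in_6[of P] corner_4_in_6[of "transposed P"] sf cor sfT corT \<open>n = 6\<close> 3
            by (simp_all add: block_sum_transp[of P])
          ultimately show ?thesis using quad nw 3 \<open>n = 6\<close> \<open>d = 2\<close> by simp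
        next
          case 4
          then have "n = 7" "d = 1" using r d by auto
          have "block_sum P 0 4 3 3 \<le> - 1" "block_sum P 4 0 3 3 \<le> - 1"
            using corner_4_in_7[of P] corner_4_in_7[of "transposed P"] sf cor sfT corT \<open>n = 7\<close> 4
              pneg[of 0 3] pneg[of 3 0]
            by (simp_all add: block_sum_transp[of P])
          then show ?thesis using quad nw centre 4 \<open>n = 7\<close> \<open>d = 1\<close> by simp
        qed
      qed
    qed
  qed
qed

text \<open>If all staircases have side less than \<open>n div 2\<close>, the four quadrants have the same sign. Otherwise
  the largest staircase can be moved to the corner, unless there is none and \<open>n \<le> 7\<close>. The value 3 for
  \<open>p\<close> stands for the absence of staircases of side 4 or more.\<close>

lemma dichotomy_holds: "5 \<le> n \<Longrightarrow> dichotomy n"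
proof (induction n rule: less_induct)
  case (less n)
  have dich: "staircase P r c m \<or> int m < \<bar>block_sum P r c m m\<bar>"
    if "zero_sum_free n P" "4 \<le> m" "m < n" "r + m \<le> n" "c + m \<le> n" for P m r c
    using block_dichotomy[OF that(1) less.prems less.IH that(2-5)] by blast
  show ?case
    unfolding dichotomy_def
  proof (intro allI impI)
    fix P assume sf: "zero_sum_free n P"
    define S where "S = {m. 4 \<le> m \<and> m \<le> n \<and> (\<exists>r c. r + m \<le> n \<and> c + m \<le> n \<and> staircase P r c m)}"
    have "finite S" unfolding S_def by (rule finite_subset[of _ "{..n}"]) auto
    define p where "p = (if S = {} then 3 else Max S)"
    have S4: "4 \<le> m" if "m \<in> S" for m using that by (simp add: S_def)
    have "3 \<le> p" using S4[of "Max S"] Max_in[OF \<open>finite S\<close>] by (cases "S = {}") (simp_all add: p_def)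
    have noS: "\<not> staircase P r c m" if "p < m" "r + m \<le> n" "c + m \<le> n" for m r c
    proof
      assume "staircase P r c m"
      then have "m \<in> S" using \<open>3 \<le> p\<close> that \<open>staircase P r c m\<close> unfolding S_def by auto
      then have "m \<le> p" using Max_ge[OF \<open>finite S\<close>] by (auto simp: p_def)
      with that(1) show False by simp
    qed
    show "staircase P 0 0 n \<or> int n < \<bar>block_sum P 0 0 n n\<bar>"
    proof (cases "2 * p + 2 \<le> n")
      case True
      define k where "k = n div 2"
      have k: "n = (n - k) + k" "k \<le> n - k" "n - k \<le> k + 1" "p < k" "4 \<le> k" "n - k < n"
        using True \<open>3 \<le> p\<close> by (auto simp: k_def)
      have "int n < \<bar>block_sum P 0 0 n n\<bar>"
      proof (rule quadrant_bound[OF k(1-3)])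
        show "int k < \<bar>block_sum P r c k k\<bar>" if "r + k \<le> n" "c + k \<le> n" for r c
          using dich[OF sf, of k r c] noS[of k r c] that k by auto
        show "int (n - k) < \<bar>block_sum P r c (n - k) (n - k)\<bar>" if "r + (n - k) \<le> n" "c + (n - k) \<le> n" for r c
          using dich[OF sf, of "n - k" r c] noS[of "n - k" r c] that k by auto
      qed
      then show ?thesis ..
    next
      case small: False
      show ?thesis
      proof (cases "S = {}")
        case True
        then have n: "n = 5 \<or> n = 6 \<or> n = 7" using small less.prems by (auto simp: p_def)
        have "int n < \<bar>block_sum P 0 0 n n\<bar>"
        proof (rule no_staircase_small[OF sf n])
          show "8 \<le> \<bar>block_sum P r c 4 4\<bar>" if "r + 4 \<le> n" "c + 4 \<le> n" for r c
            using four_block[OF sf less.prems that] noS[of 4 r c] that True by (simp add: p_def)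
        qed
        then show ?thesis ..
      next
        case False
        then have "p \<in> S" using Max_in[OF \<open>finite S\<close>] by (simp add: p_def)
        then obtain r c where p: "4 \<le> p" "p \<le> n" and rc: "r + p \<le> n" "c + p \<le> n" "staircase P r c p"
          unfolding S_def by blast
        show ?thesis
        proof (cases "p = n")
          case True
          then show ?thesis using rc by simp
        next
          case False
          obtain Q p' where Q: "symm n P Q" "p \<le> p'" "p' \<le> n" "plus_corner Q 0 0 p'"
            using staircase_to_corner[OF sf rc(3) \<open>3 \<le> p\<close> rc(1,2)] .
          have noQ: "\<not> staircase Q r c m" if "p < m" "r + m \<le> n" "c + m \<le> n" for m r c
            using staircase_symm[OF Q(1) _ that(2,3)] noS[OF that(1)] by blast
          have "p' = p"
            using noQ[of p' 0 0] corner_staircase[OF Q(4)] Q(2,3) by (cases "p < p'") simp_all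
          have sfQ: "zero_sum_free n Q" by (rule zero_sum_free_symm[OF sf Q(1)])
          have "block_sum Q 0 0 n n < - int n"
          proof (rule corner_gap[OF sfQ _ p(1)])
            show "plus_corner Q 0 0 p" using Q(4) \<open>p' = p\<close> by simp
            show "p < n" "n \<le> 2 * p + 1" using p(2) False small by simp_all
            show "staircase Q r c m \<or> int m < \<bar>block_sum Q r c m m\<bar>"
              if "4 \<le> m" "m < n" "r + m \<le> n" "c + m \<le> n" for m r c
              by (rule dich[OF sfQ that])
            show "\<not> staircase Q r c m" if "p < m" "m < n" "r + m \<le> n" "c + m \<le> n" for m r c
              by (rule noQ[OF that(1,3,4)])
          qed
          then show ?thesis using symm_block_sum[OF Q(1)] by simp
        qed
      qed
    qed
  qed
qed

section \<open>Zero-sum squares\<close>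

theorem corollary3:
  fixes M :: "int mat" and n :: nat
  assumes "M \<in> carrier_mat n n"
    and "binary_mat M"
    and "5 \<le> n"
    and "\<bar>disc M\<bar> \<le> int n - 1"
  shows "contains_zero_sum_square M"
proof (rule ccontr)
  assume no_square: "\<not> contains_zero_sum_square M"
  define P where "P = (\<lambda>i j. M $$ (i, j) = 1)"
  have dim: "dim_row M = n" "dim_col M = n" using assms(1) by auto
  have M_entry: "M $$ (i, j) = entry (P i j)" if "i < n" "j < n" for i j
  proof -
    have "M $$ (i, j) \<in> elements_mat M" using that by (intro elements_matI[OF assms(1)]) auto
    then show ?thesis using assms(2) unfolding binary_mat_def P_def entry_def by auto
  qed
  have "zero_sum_free n P"
    unfolding zero_sum_free_def
  proof (intro allI impI)
    fix i j s :: nat assume s: "0 < s" "i + s < n" "j + s < n"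
    then have "M $$ (i, j) + M $$ (i, j + s) + M $$ (i + s, j) + M $$ (i + s, j + s) \<noteq> 0"
      using no_square dim
      unfolding contains_zero_sum_square_def zero_sum_square_at_def square_at_def by auto
    then have "entry (P i j) + entry (P i (j + s)) + entry (P (i + s) j) + entry (P (i + s) (j + s)) \<noteq> 0"
      using s by (simp add: M_entry)
    then show "\<not> zero_sum (P i j) (P i (j + s)) (P (i + s) j) (P (i + s) (j + s))"
      unfolding zero_sum_def entry_def by (auto split: if_splits)
  qed
  then have "staircase P 0 0 n \<or> int n < \<bar>block_sum P 0 0 n n\<bar>"
    using dichotomy_holds[OF assms(3)] unfolding dichotomy_def by blast
  then have "int n \<le> \<bar>block_sum P 0 0 n n\<bar>"
    using staircase_sum[of P 0 0 n] assms(3) by auto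
  moreover have "disc M = block_sum P 0 0 n n"
    unfolding disc_def block_sum_def dim by (simp add: M_entry)
  ultimately show False using assms(4) by simp
qed

end
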